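(* For each integer $n \ge 2$, the group homomorphism $\bar v : B_n \to vB_n$ from the classical braid group on $n$ strands to the virtual braid group on $n$ strands, determined by $\bar v(\sigma_i) = \sigma_i$ for $1 \le i \le n-1$, is injective.
   Context: The classical braid group $B_n$ is the group generated by $\sigma_1, \ldots, \sigma_{n-1}$ subject to the relations (with all indices in $\{1,\ldots,n-1\}$): (U1) $\sigma_i\sigma_j = \sigma_j\sigma_i$ whenever $|i-j|>1$; (U2) $\sigma_i\sigma_i^{-1} = \sigma_i^{-1}\sigma_i = 1$ (automatic in a group); (U3) $\sigma_i\sigma_{i-1}\sigma_i = \sigma_{i-1}\sigma_i\sigma_{i-1}$. The virtual braid group $vB_n$ is the group generated by $\sigma_1, \ldots, \sigma_{n-1}, \tau_1, \ldots, \tau_{n-1}$ subject to the relations (U1), (U2), (U3) above together with (all indices in $\{1,\ldots,n-1\}$): (V1) $\tau_i\tau_j = \tau_j\tau_i$ whenever $|i-j|>1$; (V2) $\tau_i\tau_i = 1$; (V3) $\tau_i\tau_{i-1}\tau_i = \tau_{i-1}\tau_i\tau_{i-1}$; (V4) $\tau_i\tau_{i-1}\sigma_i = \sigma_{i-1}\tau_i\tau_{i-1}$; (V5) $\tau_i\sigma_j = \sigma_j\tau_i$ whenever $|i-j|>1$. Since the relations of $B_n$ are among those of $vB_n$, the assignment $\sigma_i \mapsto \sigma_i$ induces the homomorphism $\bar v$. *)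

theory Defs
  imports "HOL-Algebra.Group"
begin

section \<open>Groups given by generators and relations\<close>

text \<open>A letter \<open>(x, True)\<close> stands for the generator \<open>x\<close>, and \<open>(x, False)\<close> for its formal inverse.\<close>

type_synonym 'g word = "('g \<times> bool) list"

definition words :: "'g set \<Rightarrow> 'g word set" where
  "words X = lists (X \<times> UNIV)"

text \<open>The least congruence on the words over \<open>X\<close> that cancels mutually inverse letters and
  identifies the two sides of each relation \<open>(u, v) \<in> R\<close>, read as \<open>u = v\<close>.\<close>

inductive_set pres_rel :: "'g set \<Rightarrow> ('g word \<times> 'g word) set \<Rightarrow> ('g word \<times> 'g word) set"
  for X :: "'g set" and R :: "('g word \<times> 'g word) set" where
  refl: "w \<in> words X \<Longrightarrow> (w, w) \<in> pres_rel X R"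
| sym: "(u, v) \<in> pres_rel X R \<Longrightarrow> (v, u) \<in> pres_rel X R"
| trans: "(u, v) \<in> pres_rel X R \<Longrightarrow> (v, w) \<in> pres_rel X R \<Longrightarrow> (u, w) \<in> pres_rel X R"
| append: "(u, v) \<in> pres_rel X R \<Longrightarrow> (u', v') \<in> pres_rel X R \<Longrightarrow> (u @ u', v @ v') \<in> pres_rel X R"
| cancel: "x \<in> X \<Longrightarrow> ([(x, b), (x, \<not> b)], []) \<in> pres_rel X R"
| relation: "(u, v) \<in> R \<Longrightarrow> u \<in> words X \<Longrightarrow> v \<in> words X \<Longrightarrow> (u, v) \<in> pres_rel X R"

definition pres_class :: "'g set \<Rightarrow> ('g word \<times> 'g word) set \<Rightarrow> 'g word \<Rightarrow> 'g word set" where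
  "pres_class X R w = pres_rel X R `` {w}"

definition presented_group :: "'g set \<Rightarrow> ('g word \<times> 'g word) set \<Rightarrow> 'g word set monoid" where
  "presented_group X R =
     \<lparr>carrier = words X // pres_rel X R,
      mult = (\<lambda>A B. \<Union>a\<in>A. \<Union>b\<in>B. pres_class X R (a @ b)),
      one = pres_class X R []\<rparr>"

definition pres_gen :: "'g set \<Rightarrow> ('g word \<times> 'g word) set \<Rightarrow> 'g \<Rightarrow> 'g word set" where
  "pres_gen X R x = pres_class X R [(x, True)]"

fun eval_word :: "('a, 'm) monoid_scheme \<Rightarrow> ('g \<Rightarrow> 'a) \<Rightarrow> 'g word \<Rightarrow> 'a" where
  "eval_word G f [] = \<one>\<^bsub>G\<^esub>"
| "eval_word G f ((x, b) # w) = (if b then f x else inv\<^bsub>G\<^esub> (f x)) \<otimes>\<^bsub>G\<^esub> eval_word G f w"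

text \<open>The map out of a presented group induced by an assignment \<open>f\<close> of the generators: a class
  goes to the common value of its words. This is well defined when \<open>f\<close> respects the relations;
  see \<open>pres_lift_hom\<close>, \<open>pres_lift_gen\<close> and \<open>pres_hom_unique\<close> below.\<close>

definition pres_lift :: "('a, 'm) monoid_scheme \<Rightarrow> ('g \<Rightarrow> 'a) \<Rightarrow> 'g word set \<Rightarrow> 'a" where
  "pres_lift G f A = the_elem (eval_word G f ` A)"


section \<open>Classical and virtual braid groups\<close>

datatype braid_gen = BSigma nat | BTau nat

abbreviation lsig :: "nat \<Rightarrow> braid_gen \<times> bool" where "lsig i \<equiv> (BSigma i, True)"
abbreviation ltau :: "nat \<Rightarrow> braid_gen \<times> bool" where "ltau i \<equiv> (BTau i, True)"

definition far :: "nat \<Rightarrow> nat \<Rightarrow> bool" where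
  "far i j \<longleftrightarrow> \<bar>int i - int j\<bar> > 1"

text \<open>The relations \<open>\<sigma>\<^sub>i \<sigma>\<^sub>i\<^sup>-\<^sup>1 = \<sigma>\<^sub>i\<^sup>-\<^sup>1 \<sigma>\<^sub>i = 1\<close> are built into \<open>pres_rel\<close>.\<close>

definition braid_gens :: "nat \<Rightarrow> braid_gen set" where
  "braid_gens n = BSigma ` {1..n-1}"

definition braid_rels :: "nat \<Rightarrow> (braid_gen word \<times> braid_gen word) set" where
  "braid_rels n =
     {([lsig i, lsig j], [lsig j, lsig i]) | i j. i \<in> {1..n-1} \<and> j \<in> {1..n-1} \<and> far i j}
   \<union> {([lsig i, lsig (i-1), lsig i], [lsig (i-1), lsig i, lsig (i-1)]) | i. i \<in> {1..n-1} \<and> i - 1 \<in> {1..n-1}}"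

definition braid_group :: "nat \<Rightarrow> braid_gen word set monoid" where
  "braid_group n = presented_group (braid_gens n) (braid_rels n)"

definition braid_sigma :: "nat \<Rightarrow> nat \<Rightarrow> braid_gen word set" where
  "braid_sigma n i = pres_gen (braid_gens n) (braid_rels n) (BSigma i)"

definition vbraid_gens :: "nat \<Rightarrow> braid_gen set" where
  "vbraid_gens n = BSigma ` {1..n-1} \<union> BTau ` {1..n-1}"

definition vbraid_rels :: "nat \<Rightarrow> (braid_gen word \<times> braid_gen word) set" where
  "vbraid_rels n = braid_rels n
   \<union> {([ltau i, ltau j], [ltau j, ltau i]) | i j. i \<in> {1..n-1} \<and> j \<in> {1..n-1} \<and> far i j}
   \<union> {([ltau i, ltau i], []) | i. i \<in> {1..n-1}}
   \<union> {([ltau i, ltau (i-1), ltau i], [ltau (i-1), ltau i, ltau (i-1)]) | i. i \<in> {1..n-1} \<and> i - 1 \<in> {1..n-1}}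
   \<union> {([ltau i, ltau (i-1), lsig i], [lsig (i-1), ltau i, ltau (i-1)]) | i. i \<in> {1..n-1} \<and> i - 1 \<in> {1..n-1}}
   \<union> {([ltau i, lsig j], [lsig j, ltau i]) | i j. i \<in> {1..n-1} \<and> j \<in> {1..n-1} \<and> far i j}"

definition vbraid_group :: "nat \<Rightarrow> braid_gen word set monoid" where
  "vbraid_group n = presented_group (vbraid_gens n) (vbraid_rels n)"

definition vbraid_sigma :: "nat \<Rightarrow> nat \<Rightarrow> braid_gen word set" where
  "vbraid_sigma n i = pres_gen (vbraid_gens n) (vbraid_rels n) (BSigma i)"

text \<open>The assignment below is only used at the generators \<open>BSigma i\<close> of the classical braid
  group; see \<open>braid_to_vbraid_unique\<close>.\<close>

definition braid_to_vbraid :: "nat \<Rightarrow> braid_gen word set \<Rightarrow> braid_gen word set" where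
  "braid_to_vbraid n = pres_lift (vbraid_group n) (pres_gen (vbraid_gens n) (vbraid_rels n))"


section \<open>Presented groups are groups and have the universal property\<close>

lemma words_Nil [simp]: "[] \<in> words X"
  and words_Cons [simp]: "(x, b) # w \<in> words X \<longleftrightarrow> x \<in> X \<and> w \<in> words X"
  and words_append [simp]: "u @ v \<in> words X \<longleftrightarrow> u \<in> words X \<and> v \<in> words X"
  by (auto simp: words_def)

lemma pres_rel_words: "(u, v) \<in> pres_rel X R \<Longrightarrow> u \<in> words X \<and> v \<in> words X"
  by (induction rule: pres_rel.induct) auto

lemma equiv_pres_rel: "equiv (words X) (pres_rel X R)"
proof (rule equivI)
  show "pres_rel X R \<subseteq> words X \<times> words X"
    using pres_rel_words by fast
  show "refl_on (words X) (pres_rel X R)"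
    using pres_rel.refl by (fastforce intro: refl_onI)
  show "sym (pres_rel X R)"
    by (rule symI) (rule pres_rel.sym)
  show "trans (pres_rel X R)"
    by (rule transI) (rule pres_rel.trans)
qed

lemma pres_class_eq_iff:
  assumes "u \<in> words X" "v \<in> words X"
  shows "pres_class X R u = pres_class X R v \<longleftrightarrow> (u, v) \<in> pres_rel X R"
  unfolding pres_class_def by (rule eq_equiv_class_iff [OF equiv_pres_rel assms])

lemma pres_class_self: "w \<in> words X \<Longrightarrow> w \<in> pres_class X R w"
  unfolding pres_class_def by (rule equiv_class_self [OF equiv_pres_rel])

lemma carrier_presented_group:
  "carrier (presented_group X R) = pres_class X R ` words X"
  by (auto simp: presented_group_def quotient_def pres_class_def)

lemma one_presented_group: "\<one>\<^bsub>presented_group X R\<^esub> = pres_class X R []"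
  by (simp add: presented_group_def)

lemma mult_presented_group:
  assumes u: "u \<in> words X" and v: "v \<in> words X"
  shows "pres_class X R u \<otimes>\<^bsub>presented_group X R\<^esub> pres_class X R v = pres_class X R (u @ v)"
proof -
  have "pres_class X R (a @ b) = pres_class X R (u @ v)"
    if "a \<in> pres_class X R u" "b \<in> pres_class X R v" for a b
  proof -
    have "(u @ v, a @ b) \<in> pres_rel X R"
      using that by (auto simp: pres_class_def intro: pres_rel.append)
    then show ?thesis
      using pres_class_eq_iff pres_rel_words by metis
  qed
  moreover have "u \<in> pres_class X R u" "v \<in> pres_class X R v"
    using u v by (auto intro: pres_class_self)
  ultimately have "(\<Union>a\<in>pres_class X R u. \<Union>b\<in>pres_class X R v. pres_class X R (a @ b))
      = pres_class X R (u @ v)"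
    by blast
  then show ?thesis by (simp add: presented_group_def)
qed

lemma pres_rel_word_inverse:
  assumes "w \<in> words X"
  shows "\<exists>w'\<in>words X. (w' @ w, []) \<in> pres_rel X R"
  using assms
proof (induction w)
  case Nil
  then show ?case by (force intro: pres_rel.refl)
next
  case (Cons l w)
  obtain x b where l: "l = (x, b)" by force
  with Cons obtain w' where w': "w' \<in> words X" "(w' @ w, []) \<in> pres_rel X R" and x: "x \<in> X"
    and w: "w \<in> words X"
    by auto
  have "([(x, \<not> b), (x, b)], []) \<in> pres_rel X R"
    using pres_rel.cancel [OF x, of "\<not> b"] by simp
  then have "([(x, \<not> b), (x, b)] @ w, [] @ w) \<in> pres_rel X R"
    by (rule pres_rel.append [OF _ pres_rel.refl [OF w]])
  then have "(w' @ ([(x, \<not> b), (x, b)] @ w), w' @ [] @ w) \<in> pres_rel X R"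
    by (rule pres_rel.append [OF pres_rel.refl [OF w'(1)]])
  then have "((w' @ [(x, \<not> b)]) @ l # w, w' @ w) \<in> pres_rel X R"
    using l by simp
  then have "((w' @ [(x, \<not> b)]) @ l # w, []) \<in> pres_rel X R"
    using w'(2) by (rule pres_rel.trans)
  then show ?case
    using w' x by (intro bexI [of _ "w' @ [(x, \<not> b)]"]) auto
qed

lemma group_presented_group: "group (presented_group X R)"
proof (rule groupI)
  fix A assume "A \<in> carrier (presented_group X R)"
  then obtain w where w: "w \<in> words X" "A = pres_class X R w"
    by (auto simp: carrier_presented_group)
  obtain w' where "w' \<in> words X" "(w' @ w, []) \<in> pres_rel X R"
    using pres_rel_word_inverse [OF w(1)] by blast
  then show "\<exists>B\<in>carrier (presented_group X R).
      B \<otimes>\<^bsub>presented_group X R\<^esub> A = \<one>\<^bsub>presented_group X R\<^esub>"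
    using w by (intro bexI [of _ "pres_class X R w'"])
      (auto simp: carrier_presented_group one_presented_group mult_presented_group pres_class_eq_iff)
qed (auto simp: carrier_presented_group one_presented_group mult_presented_group)

lemma pres_gen_closed: "x \<in> X \<Longrightarrow> pres_gen X R x \<in> carrier (presented_group X R)"
  by (auto simp: pres_gen_def carrier_presented_group)

lemma inv_pres_gen:
  assumes x: "x \<in> X"
  shows "inv\<^bsub>presented_group X R\<^esub> pres_gen X R x = pres_class X R [(x, False)]"
proof -
  interpret group "presented_group X R" by (rule group_presented_group)
  have "([(x, False), (x, True)], []) \<in> pres_rel X R"
    using pres_rel.cancel [OF x, of False] by simp
  then have "pres_class X R [(x, False)] \<otimes>\<^bsub>presented_group X R\<^esub> pres_gen X R x
      = \<one>\<^bsub>presented_group X R\<^esub>"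
    using x by (simp add: pres_gen_def mult_presented_group one_presented_group pres_class_eq_iff)
  then show ?thesis
    using x by (intro inv_equality) (auto simp: pres_gen_def carrier_presented_group)
qed

lemma eval_pres_gen:
  assumes "w \<in> words X"
  shows "eval_word (presented_group X R) (pres_gen X R) w = pres_class X R w"
  using assms
proof (induction w)
  case Nil
  then show ?case by (simp add: one_presented_group)
next
  case (Cons l w)
  obtain x b where l: "l = (x, b)" by force
  then have x: "x \<in> X" and w: "w \<in> words X" using Cons.prems by auto
  have "(if b then pres_gen X R x else inv\<^bsub>presented_group X R\<^esub> pres_gen X R x) = pres_class X R [l]"
    using l by (simp add: inv_pres_gen [OF x]) (simp add: pres_gen_def)
  then show ?case
    using l x w Cons.IH [OF w] mult_presented_group [of "[(x, b)]" X w R] by simp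
qed

context group
begin

lemma eval_word_closed:
  assumes "f \<in> X \<rightarrow> carrier G" "w \<in> words X"
  shows "eval_word G f w \<in> carrier G"
  using assms(2)
proof (induction w)
  case (Cons l w)
  then show ?case using assms(1) by (cases l) auto
qed simp

lemma eval_word_append:
  assumes "f \<in> X \<rightarrow> carrier G" "u \<in> words X" "v \<in> words X"
  shows "eval_word G f (u @ v) = eval_word G f u \<otimes> eval_word G f v"
  using assms(2)
proof (induction u)
  case Nil
  then show ?case using eval_word_closed [OF assms(1,3)] by simp
next
  case (Cons l u)
  obtain x b where l: "l = (x, b)" by force
  have "f x \<in> carrier G" using Cons.prems assms(1) l by auto
  then show ?case
    using Cons l eval_word_closed [OF assms(1,3)] eval_word_closed [OF assms(1), of u]
    by (auto simp: m_assoc)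
qed

lemma eval_word_pres_rel:
  assumes f: "f \<in> X \<rightarrow> carrier G"
    and rels: "\<forall>(u, v)\<in>R. u \<in> words X \<longrightarrow> v \<in> words X \<longrightarrow> eval_word G f u = eval_word G f v"
    and uv: "(u, v) \<in> pres_rel X R"
  shows "eval_word G f u = eval_word G f v"
  using uv
proof (induction rule: pres_rel.induct)
  case (append u v u' v')
  then show ?case
    using pres_rel_words [OF append.hyps(1)] pres_rel_words [OF append.hyps(2)]
      eval_word_append [OF f] by simp
next
  case (cancel x b)
  then have "f x \<in> carrier G" using f by auto
  then show ?case by simp
next
  case (relation u v)
  then show ?case using rels by blast
qed simp_all

lemma pres_lift_class:
  assumes f: "f \<in> X \<rightarrow> carrier G"
    and rels: "\<forall>(u, v)\<in>R. u \<in> words X \<longrightarrow> v \<in> words X \<longrightarrow> eval_word G f u = eval_word G f v"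
    and w: "w \<in> words X"
  shows "pres_lift G f (pres_class X R w) = eval_word G f w"
proof -
  have "eval_word G f v = eval_word G f w" if "v \<in> pres_class X R w" for v
    using that eval_word_pres_rel [OF f rels, of w v] by (simp add: pres_class_def)
  then have "eval_word G f ` pres_class X R w = {eval_word G f w}"
    using pres_class_self [OF w, of R] by blast
  then show ?thesis by (simp add: pres_lift_def)
qed

lemma pres_lift_hom:
  assumes f: "f \<in> X \<rightarrow> carrier G"
    and rels: "\<forall>(u, v)\<in>R. u \<in> words X \<longrightarrow> v \<in> words X \<longrightarrow> eval_word G f u = eval_word G f v"
  shows "pres_lift G f \<in> hom (presented_group X R) G"
proof (rule homI)
  fix A B assume "A \<in> carrier (presented_group X R)" "B \<in> carrier (presented_group X R)"
  then obtain u v where uv: "u \<in> words X" "v \<in> words X"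
    "A = pres_class X R u" "B = pres_class X R v"
    by (auto simp: carrier_presented_group)
  then show "pres_lift G f (A \<otimes>\<^bsub>presented_group X R\<^esub> B) = pres_lift G f A \<otimes> pres_lift G f B"
    using pres_lift_class [OF f rels] eval_word_append [OF f] by (simp add: mult_presented_group)
next
  fix A assume "A \<in> carrier (presented_group X R)"
  then show "pres_lift G f A \<in> carrier G"
    using pres_lift_class [OF f rels] eval_word_closed [OF f] by (auto simp: carrier_presented_group)
qed

lemma pres_lift_gen:
  assumes f: "f \<in> X \<rightarrow> carrier G"
    and rels: "\<forall>(u, v)\<in>R. u \<in> words X \<longrightarrow> v \<in> words X \<longrightarrow> eval_word G f u = eval_word G f v"
    and x: "x \<in> X"
  shows "pres_lift G f (pres_gen X R x) = f x"
proof -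
  have "f x \<in> carrier G" using f x by auto
  then show ?thesis
    using pres_lift_class [OF f rels, where w = "[(x, True)]"] x by (simp add: pres_gen_def)
qed

lemma pres_hom_eval:
  assumes h: "h \<in> hom (presented_group X R) G" and w: "w \<in> words X"
  shows "h (pres_class X R w) = eval_word G (\<lambda>x. h (pres_gen X R x)) w"
proof -
  interpret P: group "presented_group X R" by (rule group_presented_group)
  interpret H: group_hom "presented_group X R" G h
    using h by unfold_locales
  show ?thesis
    using w
  proof (induction w)
    case Nil
    then show ?case using H.hom_one by (simp add: one_presented_group)
  next
    case (Cons l w)
    obtain x b where l: "l = (x, b)" by force
    then have x: "x \<in> X" and w: "w \<in> words X" using Cons.prems by auto
    have "h (pres_class X R (l # w))
        = h (pres_class X R [l] \<otimes>\<^bsub>presented_group X R\<^esub> pres_class X R w)"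
      using x w l by (simp add: mult_presented_group)
    also have "\<dots> = h (pres_class X R [l]) \<otimes> h (pres_class X R w)"
      using x w l by (intro H.hom_mult) (auto simp: carrier_presented_group)
    also have "h (pres_class X R [l]) = (if b then h (pres_gen X R x) else inv (h (pres_gen X R x)))"
    proof (cases b)
      case True
      then show ?thesis using l by (simp add: pres_gen_def)
    next
      case False
      then show ?thesis
        using l H.hom_inv [OF pres_gen_closed [OF x]] by (simp add: inv_pres_gen [OF x])
    qed
    finally show ?case using Cons.IH [OF w] l by simp
  qed
qed

lemma pres_hom_unique:
  assumes "h \<in> hom (presented_group X R) G" "k \<in> hom (presented_group X R) G"
    and gens: "\<And>x. x \<in> X \<Longrightarrow> h (pres_gen X R x) = k (pres_gen X R x)"
    and A: "A \<in> carrier (presented_group X R)"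
  shows "h A = k A"
proof -
  obtain w where w: "w \<in> words X" "A = pres_class X R w"
    using A by (auto simp: carrier_presented_group)
  have "eval_word G (\<lambda>x. h (pres_gen X R x)) w = eval_word G (\<lambda>x. k (pres_gen X R x)) w"
    using w(1) by (induction w) (auto simp: gens)
  then show ?thesis
    using pres_hom_eval assms w by metis
qed

end


section \<open>The canonical map is a well-defined homomorphism\<close>

lemma group_braid_group: "group (braid_group n)"
  by (simp add: braid_group_def group_presented_group)

lemma group_vbraid_group: "group (vbraid_group n)"
  by (simp add: vbraid_group_def group_presented_group)

lemma vbraid_gens_closed:
  "pres_gen (vbraid_gens n) (vbraid_rels n) \<in> braid_gens n \<rightarrow> carrier (vbraid_group n)"
  by (auto simp: vbraid_group_def braid_gens_def vbraid_gens_def intro!: pres_gen_closed)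

lemma vbraid_respects_braid_rels:
  "\<forall>(u, v)\<in>braid_rels n. u \<in> words (braid_gens n) \<longrightarrow> v \<in> words (braid_gens n) \<longrightarrow>
     eval_word (vbraid_group n) (pres_gen (vbraid_gens n) (vbraid_rels n)) u
   = eval_word (vbraid_group n) (pres_gen (vbraid_gens n) (vbraid_rels n)) v"
proof clarify
  fix u v
  assume assms: "(u, v) \<in> braid_rels n" "u \<in> words (braid_gens n)" "v \<in> words (braid_gens n)"
  have "words (braid_gens n) \<subseteq> words (vbraid_gens n)"
    unfolding words_def by (intro lists_mono) (auto simp: braid_gens_def vbraid_gens_def)
  then have w: "u \<in> words (vbraid_gens n)" "v \<in> words (vbraid_gens n)" using assms by auto
  moreover have "(u, v) \<in> vbraid_rels n" using assms(1) by (simp add: vbraid_rels_def)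
  ultimately have "(u, v) \<in> pres_rel (vbraid_gens n) (vbraid_rels n)"
    by (intro pres_rel.relation)
  then show "eval_word (vbraid_group n) (pres_gen (vbraid_gens n) (vbraid_rels n)) u
      = eval_word (vbraid_group n) (pres_gen (vbraid_gens n) (vbraid_rels n)) v"
    using w by (simp add: vbraid_group_def eval_pres_gen pres_class_eq_iff)
qed

lemma braid_to_vbraid_hom: "braid_to_vbraid n \<in> hom (braid_group n) (vbraid_group n)"
  unfolding braid_to_vbraid_def braid_group_def
  by (rule group.pres_lift_hom [OF group_vbraid_group vbraid_gens_closed vbraid_respects_braid_rels])

lemma braid_to_vbraid_sigma:
  assumes "i \<in> {1..n-1}"
  shows "braid_to_vbraid n (braid_sigma n i) = vbraid_sigma n i"
  unfolding braid_to_vbraid_def braid_sigma_def vbraid_sigma_def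
  by (rule group.pres_lift_gen [OF group_vbraid_group vbraid_gens_closed vbraid_respects_braid_rels])
    (use assms in \<open>auto simp: braid_gens_def\<close>)

lemma braid_to_vbraid_unique:
  assumes "h \<in> hom (braid_group n) (vbraid_group n)"
    and "\<And>i. i \<in> {1..n-1} \<Longrightarrow> h (braid_sigma n i) = vbraid_sigma n i"
    and "A \<in> carrier (braid_group n)"
  shows "h A = braid_to_vbraid n A"
proof -
  have h: "h \<in> hom (presented_group (braid_gens n) (braid_rels n)) (vbraid_group n)"
    using assms(1) by (simp add: braid_group_def)
  have k: "braid_to_vbraid n \<in> hom (presented_group (braid_gens n) (braid_rels n)) (vbraid_group n)"
    using braid_to_vbraid_hom [of n] by (simp add: braid_group_def)
  have A: "A \<in> carrier (presented_group (braid_gens n) (braid_rels n))"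
    using assms(3) by (simp add: braid_group_def)
  have "h (pres_gen (braid_gens n) (braid_rels n) x)
      = braid_to_vbraid n (pres_gen (braid_gens n) (braid_rels n) x)" if "x \<in> braid_gens n" for x
    using that assms(2) braid_to_vbraid_sigma by (auto simp: braid_gens_def braid_sigma_def)
  then show ?thesis
    by (rule group.pres_hom_unique [OF group_vbraid_group h k _ A])
qed

end

theory Submission
  imports Defs "HOL-Algebra.Bij" "HOL-Algebra.Generated_Groups"
begin

text \<open>Any rack \<open>(X, \<rhd>)\<close> gives an action of the virtual braid group on sequences in \<open>X\<close>: \<open>\<sigma>\<^sub>i\<close>
  sends the adjacent entries \<open>(x, y)\<close> to \<open>(x \<rhd> y, x)\<close>, and \<open>\<tau>\<^sub>i\<close> swaps them. It suffices
  that the restriction to the classical braid group is faithful for one rack. By induction on \<open>n\<close>,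
  write a braid as \<open>u h \<sigma>\<^bsub>n-1\<^esub> \<dots> \<sigma>\<^sub>k\<close>, where \<open>h\<close> comes from \<open>n - 1\<close> strands and \<open>u\<close> is a product
  of the loops \<open>a\<^sub>1, \<dots>, a\<^bsub>n-1\<^esub>\<close> of the last strand around the others. The rack consists of the
  permutations of a set \<open>S\<close> together with the points of \<open>S\<close>. If the braid acts trivially, then
  following a point among identity permutations yields \<open>k = n\<close>. Putting the identity in the last
  position makes \<open>u\<close> act trivially, so \<open>h\<close> acts trivially and is \<open>1\<close> by induction. Finally take
  for \<open>S\<close> the braid group itself: on the sequence whose entry \<open>i < n\<close> is left translation by \<open>a\<^sub>i\<close>
  and whose last entry is a point \<open>x\<close>, the element \<open>u\<close> only replaces \<open>x\<close> by \<open>u x\<close>; hence \<open>u = 1\<close>,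
  and no normal form in a free group is needed.\<close>

section \<open>Combing braids\<close>

text \<open>Only the braid relations for \<open>s 1\<close>, ..., \<open>s (n - 1)\<close> are
  assumed, so the combing argument applies to such elements in any group.\<close>

locale braid_elements = group G for G (structure) +
  fixes s :: "nat \<Rightarrow> 'a" and n :: nat
  assumes s_closed: "i \<in> {1..<n} \<Longrightarrow> s i \<in> carrier G"
    and s_far: "\<lbrakk>i \<in> {1..<n}; j \<in> {1..<n}; Suc i < j\<rbrakk> \<Longrightarrow> s i \<otimes> s j = s j \<otimes> s i"
    and s_braid: "\<lbrakk>i \<in> {1..<n}; Suc i \<in> {1..<n}\<rbrakk> \<Longrightarrow>
      s (Suc i) \<otimes> (s i \<otimes> s (Suc i)) = s i \<otimes> (s (Suc i) \<otimes> s i)"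
begin

section \<open>Moving a strand to the last position, and the loops of the last strand\<close>

primrec descent :: "nat \<Rightarrow> 'a" where
  "descent 0 = \<one>"
| "descent (Suc m) = descent m \<otimes> s (n - Suc m)"

text \<open>This is \<open>\<sigma>\<^bsub>n-1\<^esub> \<dots> \<sigma>\<^sub>k\<close>, which moves strand \<open>k\<close> to the last position.\<close>

definition to_last :: "nat \<Rightarrow> 'a" where
  "to_last k = descent (n - k)"

text \<open>The conjugate of \<open>s k \<otimes> s k\<close> by \<open>to_last (Suc k)\<close>: the
  standard pure braid generator in which the last strand circles strand \<open>k\<close>.\<close>

definition loop :: "nat \<Rightarrow> 'a" where
  "loop k = to_last k \<otimes> s k \<otimes> inv to_last (Suc k)"

lemma to_last_n [simp]: "to_last n = \<one>"
  by (simp add: to_last_def)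

lemma to_last_step: "k < n \<Longrightarrow> to_last k = to_last (Suc k) \<otimes> s k"
proof -
  assume "k < n"
  then have "n - k = Suc (n - Suc k)" "n - Suc (n - Suc k) = k" by auto
  then show ?thesis by (simp add: to_last_def)
qed

lemma to_last_closed [simp]: "\<lbrakk>1 \<le> k; k \<le> n\<rbrakk> \<Longrightarrow> to_last k \<in> carrier G"
proof (induction "n - k" arbitrary: k)
  case 0
  then have "k = n" by simp
  then show ?case by simp
next
  case (Suc m)
  then have "to_last (Suc k) \<in> carrier G" by simp
  with Suc show ?case by (simp add: to_last_step s_closed)
qed

lemma loop_closed [simp]: "\<lbrakk>1 \<le> k; k < n\<rbrakk> \<Longrightarrow> loop k \<in> carrier G"
  by (simp add: loop_def s_closed)

lemma loop_to_last: "\<lbrakk>1 \<le> k; k < n\<rbrakk> \<Longrightarrow> loop k \<otimes> to_last (Suc k) = to_last k \<otimes> s k"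
  by (simp add: loop_def s_closed m_assoc)

section \<open>Passing generators through \<open>to_last\<close> and through the loops\<close>

lemma to_last_s_below:
  "\<lbrakk>1 \<le> j; Suc j < k; k \<le> n\<rbrakk> \<Longrightarrow> to_last k \<otimes> s j = s j \<otimes> to_last k"
proof (induction "n - k" arbitrary: k)
  case 0
  then have "k = n" "s j \<in> carrier G" by (auto intro: s_closed)
  then show ?case by simp
next
  case (Suc m)
  then have IH: "to_last (Suc k) \<otimes> s j = s j \<otimes> to_last (Suc k)" by simp
  have "to_last k \<otimes> s j = to_last (Suc k) \<otimes> (s j \<otimes> s k)"
    using Suc by (simp add: to_last_step [of k] s_closed m_assoc s_far [of j k])
  also have "\<dots> = s j \<otimes> to_last k"
    using Suc by (simp add: to_last_step [of k] s_closed m_assoc [symmetric] IH)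
  finally show ?case .
qed

text \<open>The factors \<open>s i\<close> with \<open>i < j\<close> commute with
  \<open>s (Suc j)\<close>. The braid relation then produces
  \<open>s j \<otimes> s (Suc j) \<otimes> s j\<close>, whose leading \<open>s j\<close> passes the
  remaining factors, all of index above \<open>Suc j\<close>.\<close>

lemma to_last_s_above:
  "\<lbrakk>1 \<le> k; k \<le> j; Suc j < n\<rbrakk> \<Longrightarrow> to_last k \<otimes> s (Suc j) = s j \<otimes> to_last k"
proof (induction "n - k" arbitrary: k)
  case (Suc m)
  show ?case
  proof (cases "k = j")
    case True
    have "to_last k \<otimes> s (Suc j) = to_last (Suc (Suc j)) \<otimes> (s (Suc j) \<otimes> (s j \<otimes> s (Suc j)))"
      using Suc True by (simp add: to_last_step [of j] to_last_step [of "Suc j"] s_closed m_assoc)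
    also have "\<dots> = (to_last (Suc (Suc j)) \<otimes> s j) \<otimes> (s (Suc j) \<otimes> s j)"
      using Suc True by (simp add: s_braid s_closed m_assoc)
    also have "\<dots> = s j \<otimes> to_last k"
      using Suc True by (simp add: to_last_s_below)
        (simp add: to_last_step [of j] to_last_step [of "Suc j"] s_closed m_assoc)
    finally show ?thesis .
  next
    case False
    with Suc have IH: "to_last (Suc k) \<otimes> s (Suc j) = s j \<otimes> to_last (Suc k)" by simp
    have "to_last k \<otimes> s (Suc j) = to_last (Suc k) \<otimes> (s (Suc j) \<otimes> s k)"
      using Suc False by (simp add: to_last_step [of k] s_closed m_assoc s_far [of k "Suc j"])
    also have "\<dots> = s j \<otimes> to_last k"
      using Suc False by (simp add: to_last_step [of k] s_closed m_assoc [symmetric] IH)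
    finally show ?thesis .
  qed
qed simp

text \<open>Multiplying by \<open>to_last (Suc k)\<close> on the right clears the inverse inside
  \<open>loop k\<close>: then \<open>s j\<close> crosses \<open>to_last k\<close> as
  \<open>s (Suc j)\<close>, commutes with \<open>s k\<close>, and turns back into \<open>s j\<close>
  at \<open>to_last (Suc k)\<close>.\<close>

lemma s_loop_above:
  assumes "1 \<le> k" "k < j" "Suc j < n"
  shows "s j \<otimes> loop k = loop k \<otimes> s j"
proof -
  have "s j \<otimes> loop k \<otimes> to_last (Suc k) = (s j \<otimes> to_last k) \<otimes> s k"
    using assms by (simp add: m_assoc loop_to_last s_closed)
  also have "\<dots> = to_last k \<otimes> (s (Suc j) \<otimes> s k)"
    using assms by (simp add: to_last_s_above [symmetric] m_assoc s_closed)
  also have "\<dots> = (to_last k \<otimes> s k) \<otimes> s (Suc j)"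
    using assms by (simp add: s_far [of k "Suc j"] m_assoc s_closed)
  also have "\<dots> = loop k \<otimes> (to_last (Suc k) \<otimes> s (Suc j))"
    using assms by (simp add: loop_to_last [symmetric] m_assoc s_closed)
  also have "\<dots> = loop k \<otimes> s j \<otimes> to_last (Suc k)"
    using assms by (simp add: to_last_s_above m_assoc s_closed)
  finally show ?thesis
    using assms by (simp add: s_closed)
qed

lemma s_loop_below:
  assumes "1 \<le> j" "Suc j < k" "k < n"
  shows "s j \<otimes> loop k = loop k \<otimes> s j"
proof -
  have "s j \<otimes> loop k \<otimes> to_last (Suc k) = (s j \<otimes> to_last k) \<otimes> s k"
    using assms by (simp add: m_assoc loop_to_last s_closed)
  also have "\<dots> = to_last k \<otimes> (s j \<otimes> s k)"
    using assms by (simp add: to_last_s_below [symmetric] m_assoc s_closed)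
  also have "\<dots> = (to_last k \<otimes> s k) \<otimes> s j"
    using assms by (simp add: s_far [of j k] m_assoc s_closed)
  also have "\<dots> = loop k \<otimes> (to_last (Suc k) \<otimes> s j)"
    using assms by (simp add: loop_to_last [symmetric] m_assoc s_closed)
  also have "\<dots> = loop k \<otimes> s j \<otimes> to_last (Suc k)"
    using assms by (simp add: to_last_s_below m_assoc s_closed)
  finally show ?thesis
    using assms by (simp add: s_closed)
qed

text \<open>The braid relation replaces \<open>s j \<otimes> s (Suc j) \<otimes> s j\<close> by
  \<open>s (Suc j) \<otimes> s j \<otimes> s (Suc j)\<close>, which exposes the initial part of
  \<open>loop (Suc j)\<close>.\<close>

lemma s_loop_same:
  assumes "1 \<le> j" "Suc j < n"
  shows "s j \<otimes> loop j = loop (Suc j) \<otimes> s j"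
proof -
  have "s j \<otimes> loop j \<otimes> to_last (Suc j) = s j \<otimes> to_last j \<otimes> s j"
    using assms by (simp add: m_assoc loop_to_last s_closed)
  also have "\<dots> = to_last j \<otimes> s (Suc j) \<otimes> s j"
    using assms by (simp add: to_last_s_above)
  also have "\<dots> = to_last (Suc j) \<otimes> (s j \<otimes> (s (Suc j) \<otimes> s j))"
    using assms by (simp add: to_last_step [of j] m_assoc s_closed)
  also have "\<dots> = (to_last (Suc j) \<otimes> s (Suc j)) \<otimes> (s j \<otimes> s (Suc j))"
    using assms by (simp add: s_braid [symmetric] m_assoc s_closed)
  also have "\<dots> = loop (Suc j) \<otimes> (to_last (Suc (Suc j)) \<otimes> s j) \<otimes> s (Suc j)"
    using assms by (simp add: loop_to_last [symmetric] m_assoc s_closed)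
  also have "\<dots> = loop (Suc j) \<otimes> s j \<otimes> to_last (Suc j)"
    using assms by (simp add: to_last_s_below) (simp add: to_last_step [of "Suc j"] m_assoc s_closed)
  finally show ?thesis
    using assms by (simp add: s_closed)
qed

text \<open>Geometrically the product encircles strands \<open>j\<close> and \<open>Suc j\<close>
  together, so crossing these two does not affect it. With \<open>s_loop_same\<close> it determines
  the remaining conjugates of loops by \<open>s j\<close> and its inverse.\<close>

lemma loop_loop_s:
  assumes "1 \<le> j" "Suc j < n"
  shows "loop j \<otimes> loop (Suc j) \<otimes> s j = s j \<otimes> (loop j \<otimes> loop (Suc j))"
proof -
  let ?T = "to_last (Suc (Suc j))"
  have "loop j \<otimes> loop (Suc j) \<otimes> s j \<otimes> ?T = loop j \<otimes> (loop (Suc j) \<otimes> ?T) \<otimes> s j"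
    using assms by (simp add: m_assoc to_last_s_below [symmetric] s_closed)
  also have "\<dots> = (loop j \<otimes> to_last (Suc j)) \<otimes> s (Suc j) \<otimes> s j"
    using assms by (simp add: loop_to_last [of "Suc j"] m_assoc s_closed)
  also have "\<dots> = to_last j \<otimes> s j \<otimes> s (Suc j) \<otimes> s j"
    using assms by (simp add: loop_to_last [of j])
  also have "\<dots> = to_last (Suc j) \<otimes> s j \<otimes> (s j \<otimes> (s (Suc j) \<otimes> s j))"
    using assms by (simp add: to_last_step [of j] m_assoc s_closed)
  also have "\<dots> = to_last (Suc j) \<otimes> s j \<otimes> (s (Suc j) \<otimes> (s j \<otimes> s (Suc j)))"
    using assms by (simp add: s_braid)
  also have "\<dots> = to_last (Suc j) \<otimes> (s j \<otimes> (s (Suc j) \<otimes> s j)) \<otimes> s (Suc j)"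
    using assms by (simp add: m_assoc s_closed)
  also have "\<dots> = to_last (Suc j) \<otimes> (s (Suc j) \<otimes> (s j \<otimes> s (Suc j))) \<otimes> s (Suc j)"
    using assms by (simp add: s_braid)
  also have "\<dots> = (to_last (Suc j) \<otimes> s (Suc j)) \<otimes> s j \<otimes> s (Suc j) \<otimes> s (Suc j)"
    using assms by (simp add: m_assoc s_closed)
  also have "\<dots> = loop (Suc j) \<otimes> (?T \<otimes> s j) \<otimes> s (Suc j) \<otimes> s (Suc j)"
    using assms by (simp add: loop_to_last [symmetric] m_assoc s_closed)
  also have "\<dots> = (loop (Suc j) \<otimes> s j) \<otimes> (to_last (Suc j) \<otimes> s (Suc j))"
    using assms by (simp add: to_last_s_below) (simp add: to_last_step [of "Suc j"] m_assoc s_closed)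
  also have "\<dots> = (s j \<otimes> loop j) \<otimes> (loop (Suc j) \<otimes> ?T)"
    using assms by (simp add: s_loop_same loop_to_last)
  finally show ?thesis
    using assms by (simp add: s_closed m_assoc [symmetric])
qed

section \<open>Braids on the first \<open>n - 1\<close> strands conjugate loops into loops\<close>

definition loops :: "'a set" where
  "loops = generate G (loop ` {1..<n})"

definition stab_last :: "'a set" where
  "stab_last = generate G (s ` {1..<n - 1})"

lemma subgroup_loops: "subgroup loops G"
  unfolding loops_def by (rule generate_is_subgroup) auto

lemma subgroup_stab_last: "subgroup stab_last G"
  unfolding stab_last_def by (rule generate_is_subgroup) (auto intro!: s_closed)

lemma loop_in_loops: "\<lbrakk>1 \<le> k; k < n\<rbrakk> \<Longrightarrow> loop k \<in> loops"
  unfolding loops_def by (rule generate.incl) simp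

lemmas loops_carrier = subgroup.mem_carrier [OF subgroup_loops]
lemmas stab_last_carrier = subgroup.mem_carrier [OF subgroup_stab_last]
lemmas loops_mult = subgroup.m_closed [OF subgroup_loops]
lemmas loops_inv = subgroup.m_inv_closed [OF subgroup_loops]

text \<open>The elements \<open>u\<close> with \<open>g \<otimes> u \<otimes> inv g\<close> in
  \<open>loops\<close> form a subgroup, so the generators suffice. This gives one inclusion only,
  hence \<open>s j\<close> and \<open>inv s j\<close> are treated separately below.\<close>

lemma conj_loops:
  assumes g: "g \<in> carrier G"
    and gen: "\<And>k. \<lbrakk>1 \<le> k; k < n\<rbrakk> \<Longrightarrow> \<exists>y\<in>loops. g \<otimes> loop k = y \<otimes> g"
    and u: "u \<in> loops"
  shows "\<exists>y\<in>loops. g \<otimes> u = y \<otimes> g"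
  using u unfolding loops_def
proof (induction rule: generate.induct)
  case one
  then show ?case using g by (intro bexI [of _ \<one>]) (auto intro: generate.one)
next
  case (incl h)
  then show ?case using gen by (auto simp: loops_def)
next
  case (inv h)
  then obtain k where k: "1 \<le> k" "k < n" "h = loop k" by auto
  with gen obtain y where y: "y \<in> loops" "g \<otimes> loop k = y \<otimes> g" by blast
  then have yc: "y \<in> carrier G" by (blast intro: loops_carrier)
  have "g \<otimes> inv loop k = inv y \<otimes> (y \<otimes> g) \<otimes> inv loop k"
    using yc g k by (simp add: m_assoc [symmetric])
  also have "\<dots> = inv y \<otimes> g"
    using yc g k by (simp add: y(2) [symmetric] m_assoc)
  finally show ?case
    using loops_inv [OF y(1)] k by (auto simp: loops_def)
next
  case (eng h1 h2)
  then obtain y1 y2 where y: "y1 \<in> loops" "g \<otimes> h1 = y1 \<otimes> g" "y2 \<in> loops" "g \<otimes> h2 = y2 \<otimes> g"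
    by (auto simp: loops_def)
  have c: "y1 \<in> carrier G" "y2 \<in> carrier G" "h1 \<in> carrier G" "h2 \<in> carrier G"
    using y eng loops_carrier by (auto simp: loops_def)
  have "g \<otimes> (h1 \<otimes> h2) = y1 \<otimes> (g \<otimes> h2)"
    using c g y(2) by (simp add: m_assoc [symmetric])
  also have "\<dots> = (y1 \<otimes> y2) \<otimes> g"
    using c g y(4) by (simp add: m_assoc)
  finally show ?case
    using loops_mult [OF y(1,3)] by (auto simp: loops_def)
qed

text \<open>Turns a rule for a generator into one for its inverse; \<open>t\<close> and
  \<open>t'\<close> may differ because the loop or the \<open>to_last\<close> factor can change in
  passing.\<close>

lemma inv_swap:
  assumes "a \<in> carrier G" "b \<in> carrier G" "t \<in> carrier G" "t' \<in> carrier G" "t \<otimes> a = b \<otimes> t'"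
  shows "t' \<otimes> inv a = inv b \<otimes> t"
proof -
  have "t' = inv b \<otimes> (t \<otimes> a)"
    using assms by (simp add: m_assoc [symmetric])
  also have "\<dots> \<otimes> inv a = inv b \<otimes> t"
    using assms(1-4) by (simp add: m_assoc)
  finally show ?thesis .
qed

lemma s_conj_loop:
  assumes j: "1 \<le> j" "Suc j < n" and k: "1 \<le> k" "k < n"
  shows "\<exists>y\<in>loops. s j \<otimes> loop k = y \<otimes> s j"
proof -
  consider "k < j" | "k = j" | "k = Suc j" | "Suc j < k" by linarith
  then show ?thesis
  proof cases
    case 3
    let ?a = "loop j" and ?b = "loop (Suc j)"
    have c: "?a \<in> carrier G" "?b \<in> carrier G" "s j \<in> carrier G"
      using j by (auto intro: s_closed)
    \<comment> \<open>\<open>?b\<close> crosses \<open>s j\<close> as \<open>?a\<close>, and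
      \<open>?a \<otimes> ?b\<close> commutes with \<open>s j\<close>; so the conjugate of
      \<open>?b\<close> is \<open>inv ?b \<otimes> ?a \<otimes> ?b\<close>.\<close>
    have "?b \<otimes> (s j \<otimes> ?b) = ?a \<otimes> ?b \<otimes> s j"
      using c j by (simp add: loop_loop_s m_assoc [symmetric] s_loop_same)
    moreover have "s j \<otimes> ?b = inv ?b \<otimes> (?b \<otimes> (s j \<otimes> ?b))"
      using c by (simp add: m_assoc [symmetric])
    ultimately have "s j \<otimes> ?b = (inv ?b \<otimes> (?a \<otimes> ?b)) \<otimes> s j"
      using c by (simp add: m_assoc)
    moreover have "inv ?b \<otimes> (?a \<otimes> ?b) \<in> loops"
      using j by (intro loops_mult loops_inv loop_in_loops) auto
    ultimately show ?thesis using 3 by blast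
  next
    case 1
    with j k show ?thesis by (intro bexI [of _ "loop k"]) (simp_all add: s_loop_above loop_in_loops)
  next
    case 2
    with j k show ?thesis by (intro bexI [of _ "loop (Suc k)"]) (simp_all add: s_loop_same loop_in_loops)
  next
    case 4
    with j k show ?thesis by (intro bexI [of _ "loop k"]) (simp_all add: s_loop_below loop_in_loops)
  qed
qed

lemma inv_s_conj_loop:
  assumes j: "1 \<le> j" "Suc j < n" and k: "1 \<le> k" "k < n"
  shows "\<exists>y\<in>loops. inv s j \<otimes> loop k = y \<otimes> inv s j"
proof -
  \<comment> \<open>Reduces the claim to an equation without inverses.\<close>
  have swap: "inv s j \<otimes> loop k = y \<otimes> inv s j" if "loop k \<otimes> s j = s j \<otimes> y" "y \<in> carrier G" for y
    using inv_swap [of "s j" "s j" "loop k" y] that j k by (simp add: s_closed)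
  consider "k < j" | "k = j" | "k = Suc j" | "Suc j < k" by linarith
  then have "\<exists>y\<in>loops. loop k \<otimes> s j = s j \<otimes> y"
  proof cases
    case 2
    let ?a = "loop j" and ?b = "loop (Suc j)"
    have c: "?a \<in> carrier G" "?b \<in> carrier G" "s j \<in> carrier G"
      using j by (auto intro: s_closed)
    have "?a \<otimes> s j \<otimes> ?a = s j \<otimes> (?a \<otimes> ?b)"
      using c j by (simp add: loop_loop_s [symmetric] m_assoc s_loop_same)
    then have "?a \<otimes> s j \<otimes> ?a \<otimes> inv ?a = s j \<otimes> (?a \<otimes> ?b) \<otimes> inv ?a"
      by simp
    then have "?a \<otimes> s j = s j \<otimes> (?a \<otimes> ?b \<otimes> inv ?a)"
      using c by (simp add: m_assoc)
    moreover have "?a \<otimes> ?b \<otimes> inv ?a \<in> loops"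
      using j by (intro loops_mult loops_inv loop_in_loops) auto
    ultimately show ?thesis using 2 by blast
  next
    case 1
    with j k show ?thesis by (intro bexI [of _ "loop k"]) (simp_all add: s_loop_above loop_in_loops)
  next
    case 3
    with j k show ?thesis by (intro bexI [of _ "loop j"]) (simp_all add: s_loop_same loop_in_loops)
  next
    case 4
    with j k show ?thesis by (intro bexI [of _ "loop k"]) (simp_all add: s_loop_below loop_in_loops)
  qed
  then obtain y where "y \<in> loops" "loop k \<otimes> s j = s j \<otimes> y" ..
  then show ?thesis using swap [of y] loops_carrier [of y] by auto
qed

lemma stab_last_conj_loops:
  assumes "h \<in> stab_last" "u \<in> loops"
  shows "\<exists>y\<in>loops. h \<otimes> u = y \<otimes> h"
  using assms(1)[unfolded stab_last_def] assms(2)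
proof (induction arbitrary: u rule: generate.induct)
  case one
  then show ?case by (auto simp: loops_carrier)
next
  case (incl h)
  then obtain j where j: "1 \<le> j" "Suc j < n" "h = s j" by auto
  then show ?case
    using conj_loops [of h u] s_conj_loop [of j] incl.prems by (simp add: s_closed)
next
  case (inv h)
  then obtain j where j: "1 \<le> j" "Suc j < n" "h = s j" by auto
  then show ?case
    using conj_loops [of "inv h" u] inv_s_conj_loop [of j] inv.prems by (simp add: s_closed)
next
  case (eng h1 h2)
  then obtain y where y: "y \<in> loops" "h2 \<otimes> u = y \<otimes> h2" by blast
  with eng obtain z where z: "z \<in> loops" "h1 \<otimes> y = z \<otimes> h1" by blast
  have c: "h1 \<in> carrier G" "h2 \<in> carrier G" "u \<in> carrier G" "y \<in> carrier G" "z \<in> carrier G"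
    using eng y z stab_last_carrier loops_carrier by (auto simp: stab_last_def)
  have "h1 \<otimes> h2 \<otimes> u = (h1 \<otimes> y) \<otimes> h2"
    using c y(2) by (simp add: m_assoc)
  also have "\<dots> = z \<otimes> (h1 \<otimes> h2)"
    using c z(2) by (simp add: m_assoc)
  finally show ?case using z(1) by blast
qed

section \<open>The combed form of a braid\<close>

definition combed :: "'a set" where
  "combed = {u \<otimes> h \<otimes> to_last k |u h k. u \<in> loops \<and> h \<in> stab_last \<and> 1 \<le> k \<and> k \<le> n}"

lemma combedI:
  "\<lbrakk>u \<in> loops; h \<in> stab_last; 1 \<le> k; k \<le> n\<rbrakk> \<Longrightarrow> u \<otimes> h \<otimes> to_last k \<in> combed"
  by (auto simp: combed_def)

lemma combed_closed: "x \<in> combed \<Longrightarrow> x \<in> carrier G"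
  by (auto simp: combed_def loops_carrier stab_last_carrier)

text \<open>The new loop factor \<open>v\<close> moves left past \<open>h\<close>, changing into
  another element of \<open>loops\<close>, and merges with \<open>u\<close>.\<close>

lemma combed_loop:
  assumes "u \<in> loops" "h \<in> stab_last" "v \<in> loops" "1 \<le> k" "k \<le> n"
  shows "u \<otimes> h \<otimes> (v \<otimes> to_last k) \<in> combed"
proof -
  obtain y where y: "y \<in> loops" "h \<otimes> v = y \<otimes> h"
    using stab_last_conj_loops assms by blast
  have c: "u \<in> carrier G" "h \<in> carrier G" "v \<in> carrier G" "y \<in> carrier G"
    using assms y by (auto intro: loops_carrier stab_last_carrier)
  have "u \<otimes> h \<otimes> (v \<otimes> to_last k) = u \<otimes> (h \<otimes> v) \<otimes> to_last k"
    using c assms by (simp add: m_assoc)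
  also have "\<dots> = (u \<otimes> y) \<otimes> h \<otimes> to_last k"
    unfolding y(2) using c by (simp add: m_assoc)
  finally show ?thesis
    using combedI [OF loops_mult [OF assms(1) y(1)]] assms by simp
qed

lemma combed_stab:
  assumes "u \<in> loops" "h \<in> stab_last" "g \<in> stab_last" "1 \<le> k" "k \<le> n"
  shows "u \<otimes> h \<otimes> (g \<otimes> to_last k) \<in> combed"
proof -
  have c: "u \<in> carrier G" "h \<in> carrier G" "g \<in> carrier G"
    using assms by (auto intro: loops_carrier stab_last_carrier)
  then have "u \<otimes> h \<otimes> (g \<otimes> to_last k) = u \<otimes> (h \<otimes> g) \<otimes> to_last k"
    using assms by (simp add: m_assoc)
  then show ?thesis
    using assms by (auto intro!: combedI subgroup.m_closed [OF subgroup_stab_last])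
qed

text \<open>The elements \<open>to_last k\<close> serve as coset representatives: multiplying one by
  a generator or its inverse gives some \<open>to_last k'\<close> preceded by a factor in
  \<open>loops\<close> or \<open>stab_last\<close>, which \<open>combed_loop\<close> or
  \<open>combed_stab\<close> absorbs.\<close>

lemma combed_generator:
  assumes x: "x \<in> combed" and j: "1 \<le> j" "j < n"
  shows "x \<otimes> s j \<in> combed" "x \<otimes> inv s j \<in> combed"
proof -
  obtain u h k where uhk: "u \<in> loops" "h \<in> stab_last" "1 \<le> k" "k \<le> n"
    and x: "x = u \<otimes> h \<otimes> to_last k"
    using x by (auto simp: combed_def)
  have c: "u \<in> carrier G" "h \<in> carrier G" "s j \<in> carrier G"
    using uhk j by (auto intro: loops_carrier stab_last_carrier s_closed)
  have one: "\<one> \<in> loops" by (rule subgroup.one_closed [OF subgroup_loops])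
  have stab: "s i \<in> stab_last" "inv s i \<in> stab_last" if "1 \<le> i" "Suc i < n" for i
    using that unfolding stab_last_def by (auto intro!: generate.incl generate.inv)
  have *: "x \<otimes> y = u \<otimes> h \<otimes> (to_last k \<otimes> y)" if "y \<in> carrier G" for y
    using that c uhk x by (simp add: m_assoc)
  consider "k < j" | "k = j" | "k = Suc j" | "Suc j < k" by linarith
  then have "\<exists>g k'. 1 \<le> k' \<and> k' \<le> n \<and> (g \<in> loops \<or> g \<in> stab_last) \<and> to_last k \<otimes> s j = g \<otimes> to_last k'"
  proof cases
    case 1
    then obtain i where i: "j = Suc i" by (cases j) auto
    then show ?thesis using 1 uhk j stab(1) [of i]
      by (intro exI [of _ "s i"] exI [of _ k]) (auto simp: to_last_s_above)
  next
    \<comment> \<open>\<open>to_last j\<close> ends in \<open>s j\<close>, so \<open>s j\<close> now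
      occurs twice in a row; this square is what creates a loop.\<close>
    case 2
    then show ?thesis using j loop_in_loops [OF j]
      by (intro exI [of _ "loop j"] exI [of _ "Suc j"]) (auto simp: loop_to_last)
  next
    case 3
    then show ?thesis using j one
      by (intro exI [of _ \<one>] exI [of _ j]) (auto simp: to_last_step [of j] s_closed)
  next
    case 4
    then show ?thesis using uhk j stab(1) [of j]
      by (intro exI [of _ "s j"] exI [of _ k]) (auto simp: to_last_s_below)
  qed
  then show "x \<otimes> s j \<in> combed"
    by (auto simp only: * [OF c(3)] intro: combed_loop [OF uhk(1,2)] combed_stab [OF uhk(1,2)])
  consider "k < j" | "k = j" | "k = Suc j" | "Suc j < k" by linarith
  \<comment> \<open>For the inverse the roles change: it cancels when \<open>k = j\<close> and
    creates an inverse loop when \<open>k = Suc j\<close>.\<close>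
  then have "\<exists>g k'. 1 \<le> k' \<and> k' \<le> n \<and> (g \<in> loops \<or> g \<in> stab_last) \<and> to_last k \<otimes> inv s j = g \<otimes> to_last k'"
  proof cases
    case 1
    then obtain i where i: "j = Suc i" by (cases j) auto
    then have "to_last k \<otimes> inv s j = inv s i \<otimes> to_last k"
      using 1 uhk j by (intro inv_swap) (auto simp: to_last_s_above s_closed)
    then show ?thesis using 1 uhk j i stab(2) [of i]
      by (intro exI [of _ "inv s i"] exI [of _ k]) auto
  next
    case 2
    then have "to_last k \<otimes> inv s j = \<one> \<otimes> to_last (Suc j)"
      using uhk j c by (simp add: to_last_step [of j] m_assoc)
    then show ?thesis using one j by (intro exI [of _ \<one>] exI [of _ "Suc j"]) auto
  next
    case 3
    then have "to_last k \<otimes> inv s j = inv loop j \<otimes> to_last j"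
      using uhk j c by (intro inv_swap) (auto simp: loop_to_last)
    then show ?thesis using j loops_inv [OF loop_in_loops [OF j]]
      by (intro exI [of _ "inv loop j"] exI [of _ j]) auto
  next
    case 4
    then have "to_last k \<otimes> inv s j = inv s j \<otimes> to_last k"
      using uhk j c by (intro inv_swap) (auto simp: to_last_s_below)
    then show ?thesis using 4 uhk j stab(2) [of j]
      by (intro exI [of _ "inv s j"] exI [of _ k]) auto
  qed
  then show "x \<otimes> inv s j \<in> combed"
    by (auto simp only: * [OF inv_closed [OF c(3)]] intro: combed_loop [OF uhk(1,2)] combed_stab [OF uhk(1,2)])
qed

lemma generate_combed:
  assumes "1 \<le> n" "g \<in> generate G (s ` {1..<n})"
  shows "g \<in> combed"
proof -
  \<comment> \<open>With an arbitrary combed left factor, a product is handled by applying the claim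
    to its two factors in turn.\<close>
  have "x \<otimes> g \<in> combed" if "x \<in> combed" for x
    using assms(2) that
  proof (induction arbitrary: x rule: generate.induct)
    case (eng h1 h2)
    have "h1 \<in> carrier G" "h2 \<in> carrier G"
      using eng.hyps by (auto intro!: generate_in_carrier [of "s ` {1..<n}"] s_closed)
    then have "x \<otimes> (h1 \<otimes> h2) = x \<otimes> h1 \<otimes> h2"
      using eng.prems combed_closed by (simp add: m_assoc)
    then show ?case using eng by simp
  next
    case one
    then show ?case by (simp add: combed_closed)
  next
    case (incl h)
    then show ?case by (auto intro: combed_generator)
  next
    case (inv h)
    then show ?case by (auto intro: combed_generator)
  qed
  from this [of \<one>] have "\<one> \<in> combed \<Longrightarrow> \<one> \<otimes> g \<in> combed" .
  moreover have "\<one> \<in> combed"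
    using combedI [OF subgroup.one_closed [OF subgroup_loops] subgroup.one_closed [OF subgroup_stab_last] assms(1)]
    by simp
  moreover have "g \<in> carrier G"
    using assms(2) by (rule generate_in_carrier [rotated]) (auto intro: s_closed)
  ultimately show ?thesis by simp
qed

end


section \<open>Racks and virtual braids\<close>

lemma carrier_BijGroup_UNIV: "f \<in> carrier (BijGroup UNIV) \<longleftrightarrow> bij f"
  by (simp add: BijGroup_def Bij_def)

lemma mult_BijGroup_UNIV: "\<lbrakk>bij f; bij g\<rbrakk> \<Longrightarrow> f \<otimes>\<^bsub>BijGroup UNIV\<^esub> g = f \<circ> g"
  by (auto simp: BijGroup_def Bij_def compose_def)

lemma one_BijGroup_UNIV: "\<one>\<^bsub>BijGroup UNIV\<^esub> = id"
  by (auto simp: BijGroup_def)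

locale rack =
  fixes rack_op :: "'x \<Rightarrow> 'x \<Rightarrow> 'x" (infixr "\<rhd>" 70)
    and rack_inv_op :: "'x \<Rightarrow> 'x \<Rightarrow> 'x" (infixr "\<unrhd>" 70)
  assumes op_inv_op: "x \<rhd> (x \<unrhd> y) = y"
    and inv_op_op: "x \<unrhd> (x \<rhd> y) = y"
    and self_distrib: "x \<rhd> (y \<rhd> z) = (x \<rhd> y) \<rhd> (x \<rhd> z)"
begin

primrec move :: "braid_gen \<Rightarrow> (nat \<Rightarrow> 'x) \<Rightarrow> nat \<Rightarrow> 'x" where
  "move (BSigma i) c = c(i := c i \<rhd> c (Suc i), Suc i := c i)"
| "move (BTau i) c = c(i := c (Suc i), Suc i := c i)"

lemma bij_move: "bij (move g)"
proof (cases g)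
  case (BSigma i)
  show ?thesis
    unfolding BSigma
    by (rule bij_betw_byWitness [where f' = "\<lambda>c. c(i := c (Suc i), Suc i := c (Suc i) \<unrhd> c i)"])
      (auto simp: fun_eq_iff op_inv_op inv_op_op)
next
  case (BTau i)
  show ?thesis
    unfolding BTau
    by (rule bij_betw_byWitness [where f' = "move (BTau i)"]) (auto simp: fun_eq_iff)
qed

lemma eval_move_Cons:
  "bij (eval_word (BijGroup UNIV) move w) \<Longrightarrow>
   eval_word (BijGroup UNIV) move ((g, True) # w) = move g \<circ> eval_word (BijGroup UNIV) move w"
  by (simp add: mult_BijGroup_UNIV bij_move)

lemma bij_eval_move: "bij (eval_word (BijGroup UNIV) move w)"
  using group.eval_word_closed [OF group_BijGroup, of move UNIV UNIV w]
  by (auto simp: carrier_BijGroup_UNIV bij_move words_def)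

lemma move_far:
  assumes "far i j" "g \<in> {BSigma i, BTau i}" "h \<in> {BSigma j, BTau j}"
  shows "move g \<circ> move h = move h \<circ> move g"
proof -
  have "i \<noteq> j" "i \<noteq> Suc j" "j \<noteq> Suc i"
    using assms(1) by (auto simp: far_def)
  then show ?thesis
    using assms(2,3) by (elim insertE emptyE) (simp_all add: fun_eq_iff)
qed

text \<open>The first identity is exactly self-distributivity; in the other two the swaps only carry
  entries to and from their places.\<close>

lemma move_adjacent:
  "move (BSigma (Suc j)) \<circ> (move (BSigma j) \<circ> move (BSigma (Suc j)))
     = move (BSigma j) \<circ> (move (BSigma (Suc j)) \<circ> move (BSigma j))"
  "move (BTau (Suc j)) \<circ> (move (BTau j) \<circ> move (BTau (Suc j)))
     = move (BTau j) \<circ> (move (BTau (Suc j)) \<circ> move (BTau j))"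
  "move (BTau (Suc j)) \<circ> (move (BTau j) \<circ> move (BSigma (Suc j)))
     = move (BSigma j) \<circ> (move (BTau (Suc j)) \<circ> move (BTau j))"
  by (simp_all add: fun_eq_iff self_distrib [symmetric])

lemma move_tau_tau: "move (BTau i) \<circ> move (BTau i) = id"
  by (simp add: fun_eq_iff)

lemma move_respects_rels:
  "\<forall>(u, v)\<in>vbraid_rels n. u \<in> words X \<longrightarrow> v \<in> words X \<longrightarrow>
     eval_word (BijGroup UNIV) move u = eval_word (BijGroup UNIV) move v"
proof -
  have Cons: "eval_word (BijGroup UNIV) move ((g, True) # w) = move g \<circ> eval_word (BijGroup UNIV) move w"
    for g w by (rule eval_move_Cons [OF bij_eval_move])
  have commute: "eval_word (BijGroup UNIV) move [(g, True), (h, True)]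
      = eval_word (BijGroup UNIV) move [(h, True), (g, True)]"
    if "far i j" "g \<in> {BSigma i, BTau i}" "h \<in> {BSigma j, BTau j}" for i j g h
    using move_far [OF that] by (simp del: eval_word.simps(2) add: Cons one_BijGroup_UNIV)
  have adjacent: "eval_word (BijGroup UNIV) move [(x, True), (y, True), (z, True)]
      = eval_word (BijGroup UNIV) move [(x', True), (y', True), (z', True)]"
    if "i - 1 \<in> {1..m}" and xyz: "(x, y, z, x', y', z') \<in>
        {(BSigma i, BSigma (i - 1), BSigma i, BSigma (i - 1), BSigma i, BSigma (i - 1)),
         (BTau i, BTau (i - 1), BTau i, BTau (i - 1), BTau i, BTau (i - 1)),
         (BTau i, BTau (i - 1), BSigma i, BSigma (i - 1), BTau i, BTau (i - 1))}"
    for x y z x' y' z' i m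
  proof -
    \<comment> \<open>\<open>i - 1 \<ge> 1\<close> rules out truncated subtraction at
      \<open>i = 0\<close>.\<close>
    from that(1) have "i = Suc (i - 1)" by auto
    then obtain j where j: "i = Suc j" ..
    show ?thesis
      using xyz unfolding j
      by (auto simp del: eval_word.simps(2) move.simps simp: Cons one_BijGroup_UNIV move_adjacent)
  qed
  have square: "eval_word (BijGroup UNIV) move [(BTau i, True), (BTau i, True)]
      = eval_word (BijGroup UNIV) move []" for i
    using move_tau_tau [of i] by (simp del: eval_word.simps(2) add: Cons one_BijGroup_UNIV)
  have rels: "eval_word (BijGroup UNIV) move u = eval_word (BijGroup UNIV) move v"
    if "(u, v) \<in> vbraid_rels n" for u v
  proof -
    \<comment> \<open>All commutation relations, among the sigmas, among the taus and mixed, share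
      the case \<open>far\<close>.\<close>
    from that consider
        (far) i j x y where "far i j" "x \<in> {BSigma i, BTau i}" "y \<in> {BSigma j, BTau j}"
          "u = [(x, True), (y, True)]" "v = [(y, True), (x, True)]"
      | (involution) i where "u = [ltau i, ltau i]" "v = []"
      | (sss) i where "i - 1 \<in> {1..n-1}" "u = [lsig i, lsig (i-1), lsig i]" "v = [lsig (i-1), lsig i, lsig (i-1)]"
      | (ttt) i where "i - 1 \<in> {1..n-1}" "u = [ltau i, ltau (i-1), ltau i]" "v = [ltau (i-1), ltau i, ltau (i-1)]"
      | (tts) i where "i - 1 \<in> {1..n-1}" "u = [ltau i, ltau (i-1), lsig i]" "v = [lsig (i-1), ltau i, ltau (i-1)]"
      unfolding vbraid_rels_def braid_rels_def Un_iff mem_Collect_eq Pair_inject prod.inject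
      by (elim disjE exE conjE) (metis insertCI)+
    then show ?thesis
    proof cases
      case far
      show ?thesis unfolding far(4,5) by (rule commute [OF far(1-3)])
    next
      case involution
      show ?thesis unfolding involution by (rule square)
    next
      case sss
      show ?thesis unfolding sss(2,3) by (rule adjacent [OF sss(1)]) simp
    next
      case ttt
      show ?thesis unfolding ttt(2,3) by (rule adjacent [OF ttt(1)]) simp
    next
      case tts
      show ?thesis unfolding tts(2,3) by (rule adjacent [OF tts(1)]) simp
    qed
  qed
  then show ?thesis by blast
qed

section \<open>Inert entries and braid actions on sequences\<close>

definition inert :: "'x \<Rightarrow> bool" where
  "inert y \<longleftrightarrow> (\<forall>x. y \<rhd> x = x)"

text \<open>By self-distributivity \<open>x \<rhd> y\<close> acts as the conjugate of the action of
  \<open>y\<close> by that of \<open>x\<close>, and a conjugate of the identity is the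
  identity.\<close>

lemma inert_op: "inert y \<Longrightarrow> inert (x \<rhd> y)"
  unfolding inert_def
proof
  assume y: "\<forall>v. y \<rhd> v = v"
  show "(x \<rhd> y) \<rhd> v = v" for v
    using self_distrib [of x y "x \<unrhd> v"] y by (simp add: op_inv_op)
qed

end

text \<open>For \<open>k \<le> n\<close> the entry \<open>c n\<close> is dropped to make room. Thus
  \<open>c\<close> lists the other strands in order, independently of the position \<open>k\<close>
  of the distinguished one.\<close>

definition insert_at :: "nat \<Rightarrow> nat \<Rightarrow> 'x \<Rightarrow> (nat \<Rightarrow> 'x) \<Rightarrow> nat \<Rightarrow> 'x" where
  "insert_at n k y c = (\<lambda>i. if i < k then c i else if i = k then y else if i \<le> n then c (i - 1) else c i)"

lemma insert_at_last: "insert_at n n y c = c(n := y)"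
  by (auto simp: insert_at_def)

locale braid_rack_action = braid_elements G s n + rack rack_op rack_inv_op
  for G (structure) and s and n
    and rack_op :: "'x \<Rightarrow> 'x \<Rightarrow> 'x" (infixr "\<rhd>" 70)
    and rack_inv_op :: "'x \<Rightarrow> 'x \<Rightarrow> 'x" (infixr "\<unrhd>" 70) +
  fixes act :: "'a \<Rightarrow> (nat \<Rightarrow> 'x) \<Rightarrow> nat \<Rightarrow> 'x"
  assumes act_hom: "act \<in> hom G (BijGroup UNIV)"
    and act_s: "i \<in> {1..<n} \<Longrightarrow> act (s i) = move (BSigma i)"
begin

lemma act_mult: "\<lbrakk>x \<in> carrier G; y \<in> carrier G\<rbrakk> \<Longrightarrow> act (x \<otimes> y) c = act x (act y c)"
proof -
  assume xy: "x \<in> carrier G" "y \<in> carrier G"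
  then have "bij (act x)" "bij (act y)"
    using hom_carrier [OF act_hom] by (auto simp: carrier_BijGroup_UNIV [symmetric])
  then show ?thesis
    using hom_mult [OF act_hom xy] by (simp add: mult_BijGroup_UNIV)
qed

lemma act_one: "act \<one> c = c"
  using hom_one [OF act_hom is_group group_BijGroup] by (simp add: one_BijGroup_UNIV)

lemma act_inv: "\<lbrakk>x \<in> carrier G; act x c = d\<rbrakk> \<Longrightarrow> act (inv x) d = c"
  using act_mult [of "inv x" x c] by (auto simp: act_one)

lemma act_inv_right: "x \<in> carrier G \<Longrightarrow> act x (act (inv x) c) = c"
  using act_mult [of x "inv x" c] by (simp add: act_one)

text \<open>Each \<open>s i\<close> turns \<open>(y, x)\<close> into \<open>(y \<rhd> x, y)\<close>,
  which is \<open>(x, y)\<close> for inert \<open>y\<close>: the entry travels without altering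
  those it crosses.\<close>

lemma act_to_last:
  "\<lbrakk>1 \<le> k; k \<le> n; inert y\<rbrakk> \<Longrightarrow> act (to_last k) (insert_at n k y c) = insert_at n n y c"
proof (induction "n - k" arbitrary: k)
  case 0
  then have "k = n" by simp
  then show ?case by (simp add: act_one)
next
  case (Suc m)
  then have "act (s k) (insert_at n k y c) = insert_at n (Suc k) y c"
    by (auto simp: act_s insert_at_def inert_def fun_eq_iff)
  then show ?case
    using Suc by (simp add: to_last_step [of k] act_mult s_closed)
qed

text \<open>\<open>inv to_last (Suc k)\<close> brings \<open>y\<close> down to position
  \<open>Suc k\<close>, where \<open>s k\<close> carries it across \<open>c k\<close> and turns it
  into \<open>c k \<rhd> y\<close>; this is still inert, so \<open>to_last k\<close> returns it to
  the end with all other entries restored.\<close>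

lemma act_loop:
  assumes "1 \<le> k" "k < n" "inert y"
  shows "act (loop k) (c(n := y)) = c(n := c k \<rhd> y)"
proof -
  have "act (inv to_last (Suc k)) (insert_at n n y c) = insert_at n (Suc k) y c"
    using assms by (intro act_inv act_to_last) auto
  moreover have "act (s k) (insert_at n (Suc k) y c) = insert_at n k (c k \<rhd> y) c"
    using assms by (auto simp: act_s insert_at_def fun_eq_iff)
  moreover have "act (to_last k) (insert_at n k (c k \<rhd> y) c) = insert_at n n (c k \<rhd> y) c"
    using assms by (intro act_to_last inert_op) auto
  ultimately show ?thesis
    using assms by (simp add: loop_def act_mult s_closed insert_at_last)
qed

text \<open>The generators \<open>s j\<close> with \<open>Suc j < n\<close> neither read nor change
  position \<open>n\<close>.\<close>

lemma act_stab_last: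
  assumes "h \<in> stab_last"
  shows "act h (c(n := y)) = (act h c)(n := y)"
  using assms unfolding stab_last_def
proof (induction arbitrary: c rule: generate.induct)
  case one
  then show ?case by (simp add: act_one)
next
  case (incl h)
  then obtain j where "1 \<le> j" "Suc j < n" "h = s j" by auto
  then show ?case by (simp add: act_s fun_eq_iff)
next
  case (inv h)
  then obtain j where j: "1 \<le> j" "Suc j < n" "h = s j" by auto
  then have h: "h \<in> carrier G" by (simp add: s_closed)
  define d where "d = act (inv h) c"
  have "c = act h d"
    using h by (simp add: d_def act_inv_right)
  moreover have "act h (d(n := y)) = (act h d)(n := y)"
    using j by (simp add: act_s fun_eq_iff)
  ultimately have "act (inv h) (c(n := y)) = d(n := y)"
    by (intro act_inv h) (simp only:)
  then show ?case by (simp only: d_def)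
next
  case (eng h1 h2)
  then have "h1 \<in> carrier G" "h2 \<in> carrier G"
    using stab_last_carrier by (auto simp: stab_last_def)
  then show ?case using eng by (simp add: act_mult)
qed

lemma act_stab_last_at: "h \<in> stab_last \<Longrightarrow> act h c n = c n"
  using act_stab_last [of h c "c n"] by (metis fun_upd_same fun_upd_triv)

lemma act_stab_last_const:
  assumes "h \<in> stab_last" "x \<rhd> x = x"
  shows "act h (\<lambda>_. x) = (\<lambda>_. x)"
  using assms(1) unfolding stab_last_def
proof (induction rule: generate.induct)
  case one
  then show ?case by (simp add: act_one)
next
  case (incl h)
  then show ?case using assms(2) by (auto simp: act_s fun_eq_iff)
next
  case (inv h)
  then show ?case using assms(2) by (intro act_inv) (auto simp: act_s fun_eq_iff s_closed)
next
  case (eng h1 h2)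
  then have "h1 \<in> carrier G" "h2 \<in> carrier G"
    using stab_last_carrier by (auto simp: stab_last_def)
  then show ?case using eng by (simp add: act_mult)
qed

lemma act_loops_fixed:
  assumes u: "u \<in> loops" and y: "inert y" and fixed: "\<And>k. \<lbrakk>1 \<le> k; k < n\<rbrakk> \<Longrightarrow> c k \<rhd> y = y"
  shows "act u (c(n := y)) = c(n := y)"
  using u unfolding loops_def
proof (induction rule: generate.induct)
  case one
  then show ?case by (simp add: act_one)
next
  case (incl h)
  then obtain k where k: "1 \<le> k" "k < n" "h = loop k" by auto
  show ?case unfolding k(3) act_loop [OF k(1,2) y] fixed [OF k(1,2)] ..
next
  case (inv h)
  then obtain k where k: "1 \<le> k" "k < n" "h = loop k" by auto
  show ?case
  proof (rule act_inv)
    show "act h (c(n := y)) = c(n := y)"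
      unfolding k(3) act_loop [OF k(1,2) y] fixed [OF k(1,2)] ..
  qed (use k in simp)
next
  case (eng h1 h2)
  then have "h1 \<in> carrier G" "h2 \<in> carrier G"
    using loops_carrier by (auto simp: loops_def)
  then show ?case using eng by (simp add: act_mult)
qed

end

text \<open>Permutations act on each other by conjugation and on points by evaluation, and points act
  trivially. A function that is not bijective acts as the identity, which makes the
  operation a total rack without a separate type of permutations.\<close>

datatype 'a strand = Op "'a \<Rightarrow> 'a" | Pt 'a

definition perm_part :: "('a \<Rightarrow> 'a) \<Rightarrow> 'a \<Rightarrow> 'a" where
  "perm_part f = (if bij f then f else id)"

fun strand_op :: "'a strand \<Rightarrow> 'a strand \<Rightarrow> 'a strand" where
  "strand_op (Op f) (Op g) = Op (perm_part f \<circ> g \<circ> inv_into UNIV (perm_part f))"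
| "strand_op (Op f) (Pt x) = Pt (perm_part f x)"
| "strand_op (Pt x) v = v"

fun strand_inv_op :: "'a strand \<Rightarrow> 'a strand \<Rightarrow> 'a strand" where
  "strand_inv_op (Op f) (Op g) = Op (inv_into UNIV (perm_part f) \<circ> g \<circ> perm_part f)"
| "strand_inv_op (Op f) (Pt x) = Pt (inv_into UNIV (perm_part f) x)"
| "strand_inv_op (Pt x) v = v"

lemma bij_perm_part: "bij (perm_part f)"
  by (simp add: perm_part_def)

lemma perm_part_inv [simp]:
  "perm_part f (inv_into UNIV (perm_part f) x) = x" "inv_into UNIV (perm_part f) (perm_part f x) = x"
  using bij_perm_part [of f] by (simp_all add: bij_is_surj surj_f_inv_f bij_is_inj inv_f_f)

text \<open>Bijectivity is invariant under conjugation by \<open>p\<close>, so both sides take the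
  same branch of \<open>perm_part\<close>; in the default branch both are \<open>id\<close>. This
  yields self-distributivity where an operator acts on an operator.\<close>

lemma perm_part_conj:
  assumes "bij p"
  shows "perm_part (p \<circ> f \<circ> inv_into UNIV p) = p \<circ> perm_part f \<circ> inv_into UNIV p"
proof -
  have p: "inv_into UNIV p \<circ> p = id" "p \<circ> inv_into UNIV p = id"
    using assms by (simp_all add: bij_is_inj bij_is_surj surj_iff [symmetric])
  have "inv_into UNIV p \<circ> (p \<circ> f \<circ> inv_into UNIV p) \<circ> p = (inv_into UNIV p \<circ> p) \<circ> f \<circ> (inv_into UNIV p \<circ> p)"
    by (simp only: o_assoc)
  then have "inv_into UNIV p \<circ> (p \<circ> f \<circ> inv_into UNIV p) \<circ> p = f"
    by (simp add: p)
  then have "bij f" if "bij (p \<circ> f \<circ> inv_into UNIV p)"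
    using bij_comp [OF assms bij_comp [OF that bij_imp_bij_inv [OF assms]]] by (simp only:)
  moreover have "bij (p \<circ> f \<circ> inv_into UNIV p)" if "bij f"
    using assms that by (intro bij_comp bij_imp_bij_inv)
  ultimately have "bij (p \<circ> f \<circ> inv_into UNIV p) \<longleftrightarrow> bij f"
    by blast
  then show ?thesis
    using p by (simp add: perm_part_def)
qed

interpretation strand: rack strand_op strand_inv_op
proof
  fix x y z :: "'a strand"
  show "strand_op x (strand_inv_op x y) = y"
    by (cases x; cases y) (auto simp: fun_eq_iff)
  show "strand_inv_op x (strand_op x y) = y"
    by (cases x; cases y) (auto simp: fun_eq_iff)
  show "strand_op x (strand_op y z) = strand_op (strand_op x y) (strand_op x z)"
  proof (cases x)
    case (Op f)
    have *: "inv_into UNIV (perm_part f \<circ> perm_part g \<circ> inv_into UNIV (perm_part f))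
        = perm_part f \<circ> inv_into UNIV (perm_part g) \<circ> inv_into UNIV (perm_part f)" for g
      by (rule inv_unique_comp) (auto simp: fun_eq_iff)
    show ?thesis
      by (cases y; cases z) (auto simp: Op fun_eq_iff perm_part_conj [OF bij_perm_part] *)
  qed simp
qed

section \<open>Recovering a braid from its action\<close>

lemma perm_part_id [simp]: "perm_part id = id"
  by (simp add: perm_part_def)

lemma inert_Pt: "strand.inert (Pt x)"
  by (simp add: strand.inert_def)

lemma inert_Op_id: "strand.inert (Op id)"
  unfolding strand.inert_def
proof
  show "strand_op (Op id) v = v" for v :: "'a strand" by (cases v) auto
qed

lemma strand_op_id: "strand_op v (Op id) = Op id"
  by (cases v) (auto simp: fun_eq_iff)

text \<open>Left translation, extended by the identity off the carrier so that it permutes the whole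
  type, as \<open>perm_part\<close> requires.\<close>

definition translate :: "('a, 'm) monoid_scheme \<Rightarrow> 'a \<Rightarrow> 'a \<Rightarrow> 'a" where
  "translate G g x = (if x \<in> carrier G then g \<otimes>\<^bsub>G\<^esub> x else x)"

lemma (in group) bij_translate:
  assumes "g \<in> carrier G"
  shows "bij (translate G g)"
  by (rule bij_betw_byWitness [where f' = "translate G (inv g)"])
    (use assms in \<open>auto simp: translate_def m_assoc [symmetric]\<close>)

text \<open>The induction step of faithfulness. The hypothesis \<open>IH\<close> concerns a subgroup
  of \<open>G\<close> itself, so no embedding of a smaller braid group is presupposed.\<close>

lemma trivial_action_imp_one:
  fixes G :: "('a, 'm) monoid_scheme" and act :: "'a \<Rightarrow> (nat \<Rightarrow> 'a strand) \<Rightarrow> nat \<Rightarrow> 'a strand"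
  assumes "braid_rack_action G s n strand_op strand_inv_op act"
    and n: "1 \<le> n"
    and g: "g \<in> generate G (s ` {1..<n})"
    and trivial: "act g = id"
    and IH: "\<And>h. \<lbrakk>h \<in> generate G (s ` {1..<n - 1}); act h = id\<rbrakk> \<Longrightarrow> h = \<one>\<^bsub>G\<^esub>"
  shows "g = \<one>\<^bsub>G\<^esub>"
proof -
  interpret braid_rack_action G s n strand_op strand_inv_op act by fact
  obtain u h k where uhk: "u \<in> loops" "h \<in> stab_last" "1 \<le> k" "k \<le> n"
    and g_eq: "g = u \<otimes>\<^bsub>G\<^esub> h \<otimes>\<^bsub>G\<^esub> to_last k"
    using generate_combed [OF n g] by (auto simp: combed_def)
  have c: "u \<in> carrier G" "h \<in> carrier G"
    using uhk by (auto intro: loops_carrier stab_last_carrier)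
  have act_g: "act u (act h (act (to_last k) d)) = d" for d
    using trivial c uhk by (simp add: g_eq fun_eq_iff act_mult)
  have "k = n"
  proof (rule ccontr)
    assume "k \<noteq> n"
    \<comment> \<open>The single point starts at position \<open>k\<close>, and
      \<open>to_last k\<close> brings it to \<open>n\<close>. As all other entries are
      \<open>Op id\<close>, both \<open>h\<close> and \<open>u\<close> leave it there.\<close>
    define d e :: "nat \<Rightarrow> 'a strand"
      where "d = insert_at n k (Pt \<one>\<^bsub>G\<^esub>) (\<lambda>_. Op id)" and "e = (\<lambda>_. Op id)(n := Pt \<one>\<^bsub>G\<^esub>)"
    have "act (to_last k) d = e"
      using uhk by (simp add: d_def e_def act_to_last insert_at_last inert_Pt)
    moreover have "act h e = e"
      unfolding e_def act_stab_last [OF uhk(2)]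
      by (subst act_stab_last_const [OF uhk(2)]) (simp_all add: strand_op_id)
    moreover have "act u e = e"
      unfolding e_def by (intro act_loops_fixed) (simp_all add: uhk inert_Pt)
    ultimately have "e = d"
      using act_g [of d] by simp
    then have "e n = d n" by simp
    then show False
      using \<open>k \<noteq> n\<close> uhk by (simp add: d_def e_def insert_at_def)
  qed
  have "act h c = c" for c
  proof -
    \<comment> \<open>Every strand fixes \<open>Op id\<close>, so the loops act trivially on this
      sequence and only the effect of \<open>h\<close> remains.\<close>
    have "act u ((act h c)(n := Op id)) = (act h c)(n := Op id)"
      by (intro act_loops_fixed) (simp_all add: uhk inert_Op_id strand_op_id)
    then have "(act h c)(n := Op id) = c(n := Op id)"
      using act_g [of "c(n := Op id)"] \<open>k = n\<close> by (simp add: act_one act_stab_last [OF uhk(2)])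
    \<comment> \<open>\<open>h\<close> preserves the entry at \<open>n\<close>, so the overwritten
      value can be restored.\<close>
    then show ?thesis
      using act_stab_last_at [OF uhk(2)] by (metis fun_upd_triv fun_upd_upd)
  qed
  then have "h = \<one>\<^bsub>G\<^esub>"
    using IH [of h] uhk(2) by (simp add: stab_last_def fun_eq_iff)
  have act_u: "act u d = d" for d
    using act_g [of d] \<open>k = n\<close> \<open>h = \<one>\<^bsub>G\<^esub>\<close> by (simp add: act_one)
  \<comment> \<open>By \<open>act_loop\<close>, each loop applies its own translation to the point,
    so \<open>loops\<close> acts on the last entry by left multiplication. Starting at the identity
    then reads off \<open>u\<close>.\<close>
  define e where "e x = (\<lambda>i. Op (translate G (loop i)))(n := Pt x)" for x
  have loop: "act (loop k) (e x) = e (loop k \<otimes>\<^bsub>G\<^esub> x)"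
    if "1 \<le> k" "k < n" "x \<in> carrier G" for k x
    unfolding e_def act_loop [OF that(1,2) inert_Pt]
    using that by (simp add: perm_part_def bij_translate) (simp add: translate_def)
  have "act v (e x) = e (v \<otimes>\<^bsub>G\<^esub> x)" if "v \<in> loops" "x \<in> carrier G" for v x
    using that unfolding loops_def
  proof (induction arbitrary: x rule: generate.induct)
    case one
    then show ?case by (simp add: act_one)
  next
    case (incl h)
    then show ?case by (auto simp: loop)
  next
    case (inv h)
    then show ?case by (auto intro!: act_inv simp: loop m_assoc [symmetric])
  next
    case (eng h1 h2)
    then have "h1 \<in> carrier G" "h2 \<in> carrier G"
      using loops_carrier by (auto simp: loops_def)
    then show ?case using eng by (simp add: act_mult m_assoc)
  qed
  then have "e u = e \<one>\<^bsub>G\<^esub>"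
    using act_u [of "e \<one>\<^bsub>G\<^esub>"] uhk c by simp
  then have "e u n = e \<one>\<^bsub>G\<^esub> n" by simp
  then have "u = \<one>\<^bsub>G\<^esub>" by (simp add: e_def)
  then show ?thesis
    using \<open>h = \<one>\<^bsub>G\<^esub>\<close> \<open>k = n\<close> by (simp add: g_eq)
qed

section \<open>Faithfulness on the braid groups\<close>

lemma pres_rel_mono:
  assumes "X \<subseteq> Y" "R \<subseteq> S"
  shows "pres_rel X R \<subseteq> pres_rel Y S"
proof -
  have words: "words X \<subseteq> words Y"
    unfolding words_def using assms(1) by (intro lists_mono) auto
  have "(u, v) \<in> pres_rel Y S" if "(u, v) \<in> pres_rel X R" for u v
    using that
  proof (induction rule: pres_rel.induct)
    case (trans u v w)
    then show ?case by (blast intro: pres_rel.trans)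
  qed (use assms words in \<open>auto intro: pres_rel.intros\<close>)
  then show ?thesis by auto
qed

lemma pres_class_in_generate:
  assumes "w \<in> words X"
  shows "pres_class X R w \<in> generate (presented_group X R) (pres_gen X R ` X)"
  unfolding eval_pres_gen [OF assms, symmetric] using assms
proof (induction w)
  case Nil
  then show ?case by (simp add: generate.one)
next
  case (Cons l w)
  then show ?case
    by (cases l) (auto intro: generate.eng generate.incl generate.inv)
qed

text \<open>Expresses the factor from fewer strands as a word in fewer generators, the form in which
  the induction hypothesis is stated.\<close>

lemma generate_pres_class:
  assumes "Y \<subseteq> X" "h \<in> generate (presented_group X R) (pres_gen X R ` Y)"
  shows "\<exists>w\<in>words Y. h = pres_class X R w"
  using assms(2)
proof (induction rule: generate.induct)
  case one
  then show ?case by (intro bexI [of _ "[]"]) (simp_all add: one_presented_group)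
next
  case (incl h)
  then obtain x where "x \<in> Y" "h = pres_gen X R x" by auto
  then show ?case by (intro bexI [of _ "[(x, True)]"]) (simp_all add: pres_gen_def)
next
  case (inv h)
  then obtain x where "x \<in> Y" "h = pres_gen X R x" by auto
  then show ?case
    using assms(1) by (intro bexI [of _ "[(x, False)]"]) (auto simp: inv_pres_gen)
next
  case (eng h1 h2)
  then obtain v w where vw: "v \<in> words Y" "w \<in> words Y"
    "h1 = pres_class X R v" "h2 = pres_class X R w"
    by blast
  moreover have "words Y \<subseteq> words X"
    unfolding words_def using assms(1) by (intro lists_mono) auto
  ultimately show ?case
    by (intro bexI [of _ "v @ w"]) (simp_all add: mult_presented_group subset_iff)
qed

lemma move_closed: "strand.move \<in> X \<rightarrow> carrier (BijGroup UNIV)"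
  by (simp add: carrier_BijGroup_UNIV strand.bij_move)

lemma move_respects_braid_rels:
  "\<forall>(u, v)\<in>braid_rels n. u \<in> words X \<longrightarrow> v \<in> words X \<longrightarrow>
     eval_word (BijGroup UNIV) strand.move u = eval_word (BijGroup UNIV) strand.move v"
  using strand.move_respects_rels [of n X] by (auto simp: vbraid_rels_def)

text \<open>The lift evaluates representative words, so one definition serves every number of
  strands.\<close>

definition strand_act :: "braid_gen word set \<Rightarrow> (nat \<Rightarrow> 'x strand) \<Rightarrow> nat \<Rightarrow> 'x strand" where
  "strand_act = pres_lift (BijGroup UNIV) strand.move"

lemma strand_act_class:
  "w \<in> words (braid_gens n) \<Longrightarrow>
   strand_act (pres_class (braid_gens n) (braid_rels n) w) = eval_word (BijGroup UNIV) strand.move w"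
  unfolding strand_act_def
  by (rule group.pres_lift_class [OF group_BijGroup move_closed move_respects_braid_rels])

lemma braid_rack_action_strand:
  "braid_rack_action (braid_group n) (braid_sigma n) n strand_op strand_inv_op strand_act"
proof -
  interpret group "braid_group n" by (rule group_braid_group)
  have gens: "BSigma i \<in> braid_gens n" if "i \<in> {1..<n}" for i
    using that by (auto simp: braid_gens_def)
  have rel: "pres_class (braid_gens n) (braid_rels n) u = pres_class (braid_gens n) (braid_rels n) v"
    if "(u, v) \<in> braid_rels n" "u \<in> words (braid_gens n)" "v \<in> words (braid_gens n)" for u v
    using that by (simp add: pres_class_eq_iff pres_rel.relation)
  show ?thesis
  proof unfold_locales
    fix i assume i: "i \<in> {1..<n}"
    show "braid_sigma n i \<in> carrier (braid_group n)"
      unfolding braid_sigma_def braid_group_def by (rule pres_gen_closed [OF gens [OF i]])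
    show "strand_act (braid_sigma n i) = strand.move (BSigma i)"
      using gens [OF i] strand_act_class [of "[lsig i]" n]
      by (simp add: braid_sigma_def pres_gen_def strand.eval_move_Cons one_BijGroup_UNIV del: eval_word.simps(2))
  next
    fix i j assume ij: "i \<in> {1..<n}" "j \<in> {1..<n}" "Suc i < j"
    then have "([lsig i, lsig j], [lsig j, lsig i]) \<in> braid_rels n"
      by (auto simp: braid_rels_def far_def)
    then show "braid_sigma n i \<otimes>\<^bsub>braid_group n\<^esub> braid_sigma n j
        = braid_sigma n j \<otimes>\<^bsub>braid_group n\<^esub> braid_sigma n i"
      using gens ij rel by (simp add: braid_sigma_def pres_gen_def braid_group_def mult_presented_group)
  next
    fix i assume i: "i \<in> {1..<n}" "Suc i \<in> {1..<n}"
    then have "([lsig (Suc i), lsig (Suc i - 1), lsig (Suc i)],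
        [lsig (Suc i - 1), lsig (Suc i), lsig (Suc i - 1)]) \<in> braid_rels n"
      unfolding braid_rels_def by (intro UnI2 CollectI exI [of _ "Suc i"]) auto
    then show "braid_sigma n (Suc i) \<otimes>\<^bsub>braid_group n\<^esub> (braid_sigma n i \<otimes>\<^bsub>braid_group n\<^esub> braid_sigma n (Suc i))
        = braid_sigma n i \<otimes>\<^bsub>braid_group n\<^esub> (braid_sigma n (Suc i) \<otimes>\<^bsub>braid_group n\<^esub> braid_sigma n i)"
      using gens i rel by (simp add: braid_sigma_def pres_gen_def braid_group_def mult_presented_group)
  next
    show "strand_act \<in> hom (braid_group n) (BijGroup UNIV)"
      unfolding strand_act_def braid_group_def
      by (rule group.pres_lift_hom [OF group_BijGroup move_closed move_respects_braid_rels])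
  qed
qed

text \<open>Induction on the number of strands with one fixed rack: the type
  \<open>braid_gen word set\<close> of its points contains the carriers of all braid groups.\<close>

lemma move_faithful:
  assumes "w \<in> words (braid_gens n)"
    and "eval_word (BijGroup UNIV) (strand.move :: _ \<Rightarrow> (_ \<Rightarrow> braid_gen word set strand) \<Rightarrow> _) w = id"
  shows "(w, []) \<in> pres_rel (braid_gens n) (braid_rels n)"
  using assms
proof (induction n arbitrary: w)
  case 0
  then have "w = []" by (cases w) (auto simp: braid_gens_def)
  then show ?case by (simp add: pres_rel.refl)
next
  case (Suc n)
  let ?X = "braid_gens (Suc n)" and ?R = "braid_rels (Suc n)"
  have sub: "braid_gens n \<subseteq> ?X" "braid_rels n \<subseteq> ?R"
    by (auto simp: braid_gens_def braid_rels_def)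
  have gens: "braid_sigma m ` {1..<k} = pres_gen (braid_gens m) (braid_rels m) ` braid_gens k" for m k
    by (cases k) (simp_all add: braid_sigma_def braid_gens_def image_image atLeastLessThanSuc_atLeastAtMost)
  have "pres_class ?X ?R w = \<one>\<^bsub>braid_group (Suc n)\<^esub>"
  proof (rule trivial_action_imp_one [OF braid_rack_action_strand])
    show "pres_class ?X ?R w \<in> generate (braid_group (Suc n)) (braid_sigma (Suc n) ` {1..<Suc n})"
      unfolding gens braid_group_def by (rule pres_class_in_generate [OF Suc.prems(1)])
    show "strand_act (pres_class ?X ?R w) = (id :: (_ \<Rightarrow> braid_gen word set strand) \<Rightarrow> _)"
      by (simp only: strand_act_class [OF Suc.prems(1)] Suc.prems(2))
    fix h
    assume h: "h \<in> generate (braid_group (Suc n)) (braid_sigma (Suc n) ` {1..<Suc n - 1})"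
      and act: "strand_act h = (id :: (_ \<Rightarrow> braid_gen word set strand) \<Rightarrow> _)"
    obtain v where v: "v \<in> words (braid_gens n)" "h = pres_class ?X ?R v"
      using generate_pres_class [OF sub(1)] h by (auto simp only: gens braid_group_def diff_Suc_1)
    then have v': "v \<in> words ?X"
      using lists_mono [of "braid_gens n \<times> UNIV" "?X \<times> UNIV"] sub(1) by (auto simp: words_def)
    have "(v, []) \<in> pres_rel (braid_gens n) (braid_rels n)"
      using act unfolding v(2) strand_act_class [OF v'] by (rule Suc.IH [OF v(1)])
    \<comment> \<open>Triviality passes upwards, since the relations on \<open>n\<close> strands are
      among those on \<open>Suc n\<close>.\<close>
    then have "(v, []) \<in> pres_rel ?X ?R"
      using pres_rel_mono [OF sub] by blast
    then show "h = \<one>\<^bsub>braid_group (Suc n)\<^esub>"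
      using v v' by (simp add: braid_group_def one_presented_group pres_class_eq_iff)
  qed simp
  then show ?case
    using Suc.prems(1) by (simp add: braid_group_def one_presented_group pres_class_eq_iff)
qed

theorem theorem5:
  fixes n :: nat
  assumes "n \<ge> 2"
  shows "braid_to_vbraid n \<in> hom (braid_group n) (vbraid_group n)
       \<and> (\<forall>i\<in>{1..n-1}. braid_to_vbraid n (braid_sigma n i) = vbraid_sigma n i)
       \<and> inj_on (braid_to_vbraid n) (carrier (braid_group n))"
proof (intro conjI ballI)
  show hom: "braid_to_vbraid n \<in> hom (braid_group n) (vbraid_group n)"
    by (rule braid_to_vbraid_hom)
  show "braid_to_vbraid n (braid_sigma n i) = vbraid_sigma n i" if "i \<in> {1..n-1}" for i
    using that by (rule braid_to_vbraid_sigma)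
  interpret group_hom "braid_group n" "vbraid_group n" "braid_to_vbraid n"
    using hom by (simp add: group_hom_def group_hom_axioms_def group_braid_group group_vbraid_group)
  have "A = \<one>\<^bsub>braid_group n\<^esub>"
    if A: "A \<in> carrier (braid_group n)" and ker: "braid_to_vbraid n A = \<one>\<^bsub>vbraid_group n\<^esub>" for A
  proof -
    obtain w where w: "w \<in> words (braid_gens n)" "A = pres_class (braid_gens n) (braid_rels n) w"
      using A by (auto simp: braid_group_def carrier_presented_group)
    have "words (braid_gens n) \<subseteq> words (vbraid_gens n)"
      unfolding words_def by (intro lists_mono) (auto simp: braid_gens_def vbraid_gens_def)
    with w have w': "w \<in> words (vbraid_gens n)" by blast
    have "braid_to_vbraid n A = eval_word (vbraid_group n) (pres_gen (vbraid_gens n) (vbraid_rels n)) w"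
      unfolding braid_to_vbraid_def w(2)
      by (rule group.pres_lift_class [OF group_vbraid_group vbraid_gens_closed vbraid_respects_braid_rels w(1)])
    with ker w' have "(w, []) \<in> pres_rel (vbraid_gens n) (vbraid_rels n)"
      by (simp add: vbraid_group_def eval_pres_gen one_presented_group pres_class_eq_iff)
    \<comment> \<open>The moves satisfy all virtual relations, so a classical word that is trivial
      in the virtual braid group acts as the identity.\<close>
    then have "eval_word (BijGroup UNIV) (strand.move :: _ \<Rightarrow> (_ \<Rightarrow> braid_gen word set strand) \<Rightarrow> _) w = id"
      using group.eval_word_pres_rel [OF group_BijGroup move_closed strand.move_respects_rels, of w "[]"]
      by (simp add: one_BijGroup_UNIV)
    then have "(w, []) \<in> pres_rel (braid_gens n) (braid_rels n)"
      by (rule move_faithful [OF w(1)])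
    then show ?thesis
      using w by (simp add: braid_group_def one_presented_group pres_class_eq_iff)
  qed
  then show "inj_on (braid_to_vbraid n) (carrier (braid_group n))"
    by (simp add: inj_on_one_iff)
qed

end
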